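(* Consider the family of symmetrically coupled stochastic oscillators $$d\mathbf{X} = [\mathbf{f}(\mathbf{X}) + \tau\mathbf{u}_1(\mathbf{X}) + \kappa\mathbf{h}(\mathbf{X},\mathbf{Y})]dt + \mathbf{g}_1(\mathbf{X})d\mathbf{W}_1(t),\qquad d\mathbf{Y} = [\mathbf{f}(\mathbf{Y}) + \tau\mathbf{u}_2(\mathbf{Y}) +\kappa\mathbf{h}(\mathbf{Y},\mathbf{X})]dt + \mathbf{g}_2(\mathbf{Y})d\mathbf{W}_2(t)$$ on $\mathbb{R}^n\times\mathbb{R}^n$, with oscillators that are identical when unperturbed ($\mathbf{g}_1=\mathbf{g}_2$), and assume the coupled oscillator criteria (stated in the context) hold. Define the $2\times2$ complex matrix $$\mathcal{M}(\kappa,\tau)=\begin{bmatrix}\iint P_{1x}[\tau\mathcal{L}_\tau^\dagger+\kappa\mathcal{L}_\kappa^\dagger]Q_{1x}^* \,d\mathbf{x}\,d\mathbf{y}& \iint P_{1x}[\tau\mathcal{L}_\tau^\dagger+\kappa\mathcal{L}_\kappa^\dagger]Q_{1y}^*\,d\mathbf{x}\,d\mathbf{y}\\ \iint P_{1y}[\tau\mathcal{L}_\tau^\dagger+\kappa\mathcal{L}_\kappa^\dagger]Q_{1x}^*\,d\mathbf{x}\,d\mathbf{y} & \iint P_{1y}[\tau\mathcal{L}_\tau^\dagger+\kappa\mathcal{L}_\kappa^\dagger]Q_{1y}^*\,d\mathbf{x}\,d\mathbf{y}\end{bmatrix},$$ all integrals being over $\mathbb{R}^{2n}$. Then, for any fixed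 $(\kappa,\tau)\in\mathcal{K}\times\mathcal{T}$ for which $\mathcal{M}$ is diagonalizable with eigenpairs $(\lambda_{c\pm}(\kappa,\tau),v_\pm(\kappa,\tau))$, there exist unique (for a fixed, a priori normalization of the unperturbed $Q$-functions) functions $\mathcal{Q}_{c+}(\mathbf{x},\mathbf{y};\kappa,\tau)$ and $\mathcal{Q}_{c-}(\mathbf{x},\mathbf{y};\kappa,\tau)$ that satisfy $$(\mathcal{L}_x^\dagger+\mathcal{L}_y^\dagger-\lambda_1)\mathcal{Q}_{c\pm}^*(\mathbf{x},\mathbf{y};\kappa,\tau) = -\big(\tau\mathcal{L}_\tau^\dagger+\kappa\mathcal{L}_\kappa^\dagger-\lambda_{c\pm}(\kappa,\tau)\big)\Big((v_\pm(\kappa,\tau))_1Q_{1x}^*(\mathbf{x},\mathbf{y})+(v_\pm(\kappa,\tau))_2Q_{1y}^*(\mathbf{x},\mathbf{y})\Big)$$ (upper signs together, lower signs together), together with the orthogonality conditions $$\mathcal{Q}_{c+}^*(\mathbf{x},\mathbf{y};\kappa,\tau)\perp P_{1x}(\mathbf{x},\mathbf{y}),\,P_{1y}(\mathbf{x},\mathbf{y}),\qquad \mathcal{Q}_{c-}^*(\mathbf{x},\mathbf{y};\kappa,\tau)\perp P_{1x}(\mathbf{x},\mathbf{y}),\,P_{1y}(\mathbf{x},\mathbf{y}),$$ where $(v_\pm(\kappa,\tau))_j$ is the $j$th entry of $v_\pm(\kappa,\tau)$, $j=1,2$. Under the re-parameterization $(\kappa,\tau)\to(\epsilon\kappa,\epsilon\tau)$,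 the $Q$-functions and eigenvalues of the joint system are given to leading order in $\epsilon$ by $$\mathcal{Q}_\pm^*(\mathbf{x},\mathbf{y};\epsilon\kappa,\epsilon\tau) = (v_\pm(\kappa,\tau))_1Q_{1x}^*(\mathbf{x},\mathbf{y})+(v_\pm(\kappa,\tau))_2Q_{1y}^*(\mathbf{x},\mathbf{y})+\epsilon\,\mathcal{Q}_{c\pm}^*(\mathbf{x},\mathbf{y};\kappa,\tau)+\mathcal{O}(\epsilon^2),$$ $$\lambda_\pm(\epsilon\kappa,\epsilon\tau)=\lambda_1+\epsilon\,\lambda_{c\pm}(\kappa,\tau)+\mathcal{O}(\epsilon^2).$$
   Context: Setting. The SDE is in the sense of It\^o; $\mathbf{f},\mathbf{u}_1,\mathbf{u}_2:\mathbb{R}^n\to\mathbb{R}^n$ and $\mathbf{h}:\mathbb{R}^n\times\mathbb{R}^n\to\mathbb{R}^n$ are $\mathcal{C}^2$ vector fields; $\mathbf{g}_1,\mathbf{g}_2$ are $n\times m$ matrices with $\mathcal{C}^2$ entries, nonsingular in the sense that $\mathbf{g}_i\mathbf{g}_i^T$ is nonsingular; the components of $d\mathbf{W}_1,d\mathbf{W}_2$ are increments of independent Wiener processes. $\kappa$ is the coupling strength and $\tau$ the detuning parameter. Operators. The backward operators (stochastic Koopman operators, SKO) are $\mathcal{L}_x^\dagger = \mathbf{f}(\mathbf{x})\cdot\nabla_x + \frac12\sum_{ij}[\mathbf{g}_1\mathbf{g}_1^T(\mathbf{x})]_{ij}\partial_{x_ix_j}$, $\mathcal{L}_y^\dagger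 = \mathbf{f}(\mathbf{y})\cdot\nabla_y + \frac12\sum_{ij}[\mathbf{g}_2\mathbf{g}_2^T(\mathbf{y})]_{ij}\partial_{y_iy_j}$, $\mathcal{L}_\tau^\dagger = \mathbf{u}_1(\mathbf{x})\cdot\nabla_x+\mathbf{u}_2(\mathbf{y})\cdot\nabla_y$, $\mathcal{L}_\kappa^\dagger=\mathbf{h}(\mathbf{x},\mathbf{y})\cdot\nabla_x+\mathbf{h}(\mathbf{y},\mathbf{x})\cdot\nabla_y$. The forward (Fokker-Planck) operators $\mathcal{L}_x,\mathcal{L}_y,\mathcal{L}_\tau,\mathcal{L}_\kappa$ are their formal adjoints with respect to the standard $L^2$ pairing. The joint backward operator is $\mathcal{L}_x^\dagger+\mathcal{L}_y^\dagger+\tau\mathcal{L}_\tau^\dagger+\kappa\mathcal{L}_\kappa^\dagger$ (and similarly for the forward operator). Forward operators act on $\mathcal{C}^2\cap L_1$ functions; backward operators act on $\mathcal{C}^2$ functions bounded on compact sets. Superscript $*$ on a function denotes complex conjugation; backward eigenfunctions are written $Q^*$. $Q^*\perp P$ means $\iint Q^*P\,d\mathbf{x}\,d\mathbf{y}=0$. Robustly oscillatory criteria (for a single oscillator): (1) all eigenvalues of the SKO apart from the stationary eigenvalue $\lambda_0=0$ have negative real parts; (2) the first nontrivial eigenvalue $\lambda_1=\mu\pm i\omega$ is a unique complex-conjugate pair with quality factor $|\omega/\mu|\gg1$; (3) all other eigenvalues $\lambda'$ have more negative real parts, $\Re[\lambda']<\upsilon\,\Re[\lambda_1]$ with $0<\upsilon\in\mathbb{R}$.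 The stationary distribution is unique. Coupled oscillator criteria: (A) When $\kappa=\tau=0$: each individual oscillator satisfies the robustly oscillatory criteria; the forward and backward operators of the isolated oscillators and of the joint system have a discrete eigenvalue spectrum (no accumulation point at zero) and a complete bi-orthonormal set of eigenfunctions, i.e. $\mathcal{L}P_\lambda=\lambda P_\lambda$, $\mathcal{L}^\dagger Q_\lambda^*=\lambda Q_\lambda^*$, $\int Q^*_\lambda P_{\lambda'}=\delta_{\lambda,\lambda'}$; the Fredholm alternative holds for both the forward and backward operators of the joint system (for an operator $L$ with adjoint $L^\dagger$: the solution of $Lu=f$ is unique iff $Lu=0$ has only the trivial solution, and a solution exists iff $\langle f,v\rangle=0$ for all $v$ with $L^\dagger v=0$). (B) There exist open sets $\mathcal{K},\mathcal{T}\subseteq\mathbb{R}$ containing $0$ such that for all $(\kappa,\tau)\in\mathcal{K}\times\mathcal{T}$: the joint system admits a unique stationary distribution, corresponding to the unique zero eigenvalue of its forward operator; this stationary distribution, evaluated at $(\epsilon\kappa,\epsilon\tau)$, has $\mathcal{C}^1$ dependence on $\epsilon$ for $|\epsilon|\le1$; and all other forward and backward eigenfunctions and corresponding eigenvalues, evaluated at $(\epsilon\kappa,\epsilon\tau)$, are also $\mathcal{C}^1$ in $\epsilon$ for $|\epsilon|\le1$. Unperturbed $Q$-functions. $P_0$ is the stationary density of an isolated oscillator. $\lambda_1=\mu+i\omega$ is the leading nontrivial eigenvalue (of a fixed sign of imaginary part) of the isolated oscillator, with backward eigenfunction $Q_1^*$ (the $Q$-function) and forward eigenfunction $P_1$,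 normalized so that $\int Q_1^*P_1=1$ and $Q_1^*$ has unit variance under $P_0$. For the joint identical system at $\kappa=\tau=0$ set $Q_{1x}^*(\mathbf{x},\mathbf{y})=Q_1^*(\mathbf{x})$, $Q_{1y}^*(\mathbf{x},\mathbf{y})=Q_1^*(\mathbf{y})$, $P_{1x}(\mathbf{x},\mathbf{y})=P_1(\mathbf{x})P_0(\mathbf{y})$, $P_{1y}(\mathbf{x},\mathbf{y})=P_1(\mathbf{y})P_0(\mathbf{x})$; $\lambda_1$ then has multiplicity $2$. The normalization still leaves the unperturbed $Q$-functions free up to rotations $e^{i\xi},e^{i\Xi}$; such a choice is fixed a priori. Perturbed $Q$-functions. $\mathcal{Q}_\pm^*(\mathbf{x},\mathbf{y};\kappa,\tau)$, with eigenvalues $\lambda_\pm(\kappa,\tau)$, denote the two eigenfunctions of the joint backward operator that emanate from the two-dimensional $\lambda_1$-eigenspace at $\kappa=\tau=0$: $(\mathcal{L}_x^\dagger+\mathcal{L}_y^\dagger+\tau\mathcal{L}_\tau^\dagger+\kappa\mathcal{L}_\kappa^\dagger)\mathcal{Q}_\pm^*=\lambda_\pm\mathcal{Q}_\pm^*$.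
   Formalization: Criteria posed on chosen function spaces, backward one Banach with closed operators; C¹ taken in graph norm. Q± expansion holds if its P1x,P1y components are v± up to O(ε²), else with actual components as coefficients. Eigenpairs up to sign/scale; if λc± coincide, basis set by Q± at ε=0. *)

theory Defs
  imports "HOL-Analysis.Analysis" "HOL-Library.Function_Algebras" "HOL-Library.Landau_Symbols"
begin

section \<open>Complex-valued functions\<close>

text \<open>
  Sums, differences and products of functions are the pointwise ones of
  \<^theory>\<open>HOL-Library.Function_Algebras\<close>.
\<close>

definition cscale :: "complex \<Rightarrow> ('a \<Rightarrow> complex) \<Rightarrow> ('a \<Rightarrow> complex)" where
  "cscale c u = (\<lambda>z. c * u z)"

global_interpretation cfun: vector_space cscale
  by unfold_locales (auto simp: cscale_def fun_eq_iff algebra_simps)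

definition C1_fun :: "('a::euclidean_space \<Rightarrow> 'b::real_normed_vector) \<Rightarrow> bool" where
  "C1_fun u \<longleftrightarrow> (\<forall>z. u differentiable (at z)) \<and>
     (\<forall>v. continuous_on UNIV (\<lambda>z. frechet_derivative u (at z) v))"

definition C2_fun :: "('a::euclidean_space \<Rightarrow> 'b::real_normed_vector) \<Rightarrow> bool" where
  "C2_fun u \<longleftrightarrow> C1_fun u \<and> (\<forall>v. C1_fun (\<lambda>z. frechet_derivative u (at z) v))"

text \<open>
  The integral of \<open>q * p\<close>. Backward functions are written with a star in the mathematical
  notation (\<open>Q\<^sup>*\<close>); the functions called \<open>Q\<close> below stand for the starred
  functions themselves, so that no conjugation occurs in the pairing.
\<close>

definition pairing :: "('a::euclidean_space \<Rightarrow> complex) \<Rightarrow> ('a \<Rightarrow> complex) \<Rightarrow> complex" where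
  "pairing q p = (\<integral>z. q z * p z \<partial>lborel)"

section \<open>Backward and forward operators\<close>

definition pd :: "'n \<Rightarrow> (real^'n \<Rightarrow> complex) \<Rightarrow> real^'n \<Rightarrow> complex" where
  "pd i u x = frechet_derivative u (at x) (axis i 1)"

definition bwd_transport :: "(real^'n \<Rightarrow> real^'n) \<Rightarrow> (real^'n \<Rightarrow> complex) \<Rightarrow> (real^'n \<Rightarrow> complex)" where
  "bwd_transport a u = (\<lambda>x. \<Sum>i\<in>UNIV. of_real (a x $ i) * pd i u x)"

definition fwd_transport :: "(real^'n \<Rightarrow> real^'n) \<Rightarrow> (real^'n \<Rightarrow> complex) \<Rightarrow> (real^'n \<Rightarrow> complex)" where
  "fwd_transport a p = (\<lambda>x. - (\<Sum>i\<in>UNIV. pd i (\<lambda>x'. of_real (a x' $ i) * p x') x))"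

definition diffusion :: "(real^'n \<Rightarrow> real^'m^'n) \<Rightarrow> real^'n \<Rightarrow> real^'n^'n" where
  "diffusion g x = g x ** transpose (g x)"

definition bwd_diffusion :: "(real^'n \<Rightarrow> real^'m^'n) \<Rightarrow> (real^'n \<Rightarrow> complex) \<Rightarrow> (real^'n \<Rightarrow> complex)" where
  "bwd_diffusion g u = (\<lambda>x. (1/2) *
     (\<Sum>i\<in>UNIV. \<Sum>j\<in>UNIV. of_real (diffusion g x $ i $ j) * pd i (pd j u) x))"

definition fwd_diffusion :: "(real^'n \<Rightarrow> real^'m^'n) \<Rightarrow> (real^'n \<Rightarrow> complex) \<Rightarrow> (real^'n \<Rightarrow> complex)" where
  "fwd_diffusion g p = (\<lambda>x. (1/2) *
     (\<Sum>i\<in>UNIV. \<Sum>j\<in>UNIV. pd i (pd j (\<lambda>x'. of_real (diffusion g x' $ i $ j) * p x')) x))"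

definition bwd_osc :: "(real^'n \<Rightarrow> real^'n) \<Rightarrow> (real^'n \<Rightarrow> real^'m^'n)
    \<Rightarrow> (real^'n \<Rightarrow> complex) \<Rightarrow> (real^'n \<Rightarrow> complex)" where
  "bwd_osc f g u = bwd_transport f u + bwd_diffusion g u"

definition fwd_osc :: "(real^'n \<Rightarrow> real^'n) \<Rightarrow> (real^'n \<Rightarrow> real^'m^'n)
    \<Rightarrow> (real^'n \<Rightarrow> complex) \<Rightarrow> (real^'n \<Rightarrow> complex)" where
  "fwd_osc f g p = fwd_transport f p + fwd_diffusion g p"

text \<open>
  An operator acting in the first (second) variable only; it may depend on the value of the
  other, frozen variable, as the coupling term does.
\<close>

definition in_x :: "('b \<Rightarrow> ('a \<Rightarrow> complex) \<Rightarrow> ('a \<Rightarrow> complex)) \<Rightarrow> ('a \<times> 'b \<Rightarrow> complex) \<Rightarrow> ('a \<times> 'b \<Rightarrow> complex)" where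
  "in_x A u = (\<lambda>(x, y). A y (\<lambda>x'. u (x', y)) x)"

definition in_y :: "('a \<Rightarrow> ('b \<Rightarrow> complex) \<Rightarrow> ('b \<Rightarrow> complex)) \<Rightarrow> ('a \<times> 'b \<Rightarrow> complex) \<Rightarrow> ('a \<times> 'b \<Rightarrow> complex)" where
  "in_y A u = (\<lambda>(x, y). A x (\<lambda>y'. u (x, y')) y)"

text \<open>
  Coefficients \<open>f, g\<^sub>1, g\<^sub>2, u\<^sub>1, u\<^sub>2, h\<close> of the coupled Ito equations
  \<open>dX = [f(X) + \<tau> u\<^sub>1(X) + \<kappa> h(X,Y)] dt + g\<^sub>1(X) dW\<^sub>1\<close> and
  \<open>dY = [f(Y) + \<tau> u\<^sub>2(Y) + \<kappa> h(Y,X)] dt + g\<^sub>2(Y) dW\<^sub>2\<close>.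
\<close>

record ('n, 'm) oscillators =
  drift :: "real^'n \<Rightarrow> real^'n"
  noise_x :: "real^'n \<Rightarrow> real^'m^'n"
  noise_y :: "real^'n \<Rightarrow> real^'m^'n"
  detune_x :: "real^'n \<Rightarrow> real^'n"
  detune_y :: "real^'n \<Rightarrow> real^'n"
  coupling :: "real^'n \<Rightarrow> real^'n \<Rightarrow> real^'n"

definition regular_coefficients :: "('n::finite, 'm::finite) oscillators \<Rightarrow> bool" where
  "regular_coefficients S \<longleftrightarrow>
     C2_fun (drift S) \<and> C2_fun (detune_x S) \<and> C2_fun (detune_y S) \<and>
     C2_fun (\<lambda>(x, y). coupling S x y) \<and>
     (\<forall>i j. C2_fun (\<lambda>x. noise_x S x $ i $ j)) \<and> (\<forall>i j. C2_fun (\<lambda>x. noise_y S x $ i $ j)) \<and>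
     (\<forall>x. invertible (diffusion (noise_x S) x)) \<and> (\<forall>x. invertible (diffusion (noise_y S) x))"

type_synonym 'n joint = "(real^'n) \<times> (real^'n) \<Rightarrow> complex"

definition bwd_x :: "('n::finite, 'm::finite) oscillators \<Rightarrow> 'n joint \<Rightarrow> 'n joint" where
  "bwd_x S = in_x (\<lambda>_. bwd_osc (drift S) (noise_x S))"

definition bwd_y :: "('n::finite, 'm::finite) oscillators \<Rightarrow> 'n joint \<Rightarrow> 'n joint" where
  "bwd_y S = in_y (\<lambda>_. bwd_osc (drift S) (noise_y S))"

definition bwd_tau :: "('n::finite, 'm::finite) oscillators \<Rightarrow> 'n joint \<Rightarrow> 'n joint" where
  "bwd_tau S u = in_x (\<lambda>_. bwd_transport (detune_x S)) u + in_y (\<lambda>_. bwd_transport (detune_y S)) u"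

definition bwd_kappa :: "('n::finite, 'm::finite) oscillators \<Rightarrow> 'n joint \<Rightarrow> 'n joint" where
  "bwd_kappa S u = in_x (\<lambda>y. bwd_transport (\<lambda>x. coupling S x y)) u
                 + in_y (\<lambda>x. bwd_transport (\<lambda>y. coupling S y x)) u"

definition fwd_x :: "('n::finite, 'm::finite) oscillators \<Rightarrow> 'n joint \<Rightarrow> 'n joint" where
  "fwd_x S = in_x (\<lambda>_. fwd_osc (drift S) (noise_x S))"

definition fwd_y :: "('n::finite, 'm::finite) oscillators \<Rightarrow> 'n joint \<Rightarrow> 'n joint" where
  "fwd_y S = in_y (\<lambda>_. fwd_osc (drift S) (noise_y S))"

definition fwd_tau :: "('n::finite, 'm::finite) oscillators \<Rightarrow> 'n joint \<Rightarrow> 'n joint" where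
  "fwd_tau S p = in_x (\<lambda>_. fwd_transport (detune_x S)) p + in_y (\<lambda>_. fwd_transport (detune_y S)) p"

definition fwd_kappa :: "('n::finite, 'm::finite) oscillators \<Rightarrow> 'n joint \<Rightarrow> 'n joint" where
  "fwd_kappa S p = in_x (\<lambda>y. fwd_transport (\<lambda>x. coupling S x y)) p
                 + in_y (\<lambda>x. fwd_transport (\<lambda>y. coupling S y x)) p"

definition bwd_perturbation :: "('n::finite, 'm::finite) oscillators \<Rightarrow> real \<Rightarrow> real \<Rightarrow> 'n joint \<Rightarrow> 'n joint" where
  "bwd_perturbation S \<kappa> \<tau> u = cscale (of_real \<tau>) (bwd_tau S u) + cscale (of_real \<kappa>) (bwd_kappa S u)"

definition bwd :: "('n::finite, 'm::finite) oscillators \<Rightarrow> real \<Rightarrow> real \<Rightarrow> 'n joint \<Rightarrow> 'n joint" where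
  "bwd S \<kappa> \<tau> u = bwd_x S u + bwd_y S u + bwd_perturbation S \<kappa> \<tau> u"

definition fwd :: "('n::finite, 'm::finite) oscillators \<Rightarrow> real \<Rightarrow> real \<Rightarrow> 'n joint \<Rightarrow> 'n joint" where
  "fwd S \<kappa> \<tau> p = fwd_x S p + fwd_y S p
     + cscale (of_real \<tau>) (fwd_tau S p) + cscale (of_real \<kappa>) (fwd_kappa S p)"

section \<open>Function spaces\<close>

text \<open>
  On all \<open>C\<^sup>2\<close> functions, respectively on all \<open>C\<^sup>2\<close> functions in
  \<open>L\<^sub>1\<close>, an operator of the present kind need not have discrete spectrum or satisfy
  the Fredholm alternative: growth at infinity has to be controlled. The spectral hypotheses are
  therefore relative to a space \<open>Obs\<close> of continuous functions (automatically bounded on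
  compact sets) for the backward operators and a space \<open>Den\<close> of continuous \<open>L\<^sub>1\<close>
  functions for the forward operators; both are arbitrary. The operators act on the
  \<open>C\<^sup>2\<close> functions that they map into the space.
\<close>

definition dual_spaces :: "('a::euclidean_space \<Rightarrow> complex) set \<Rightarrow> ('a \<Rightarrow> complex) set \<Rightarrow> bool" where
  "dual_spaces Obs Den \<longleftrightarrow>
     cfun.subspace Obs \<and> cfun.subspace Den \<and> (\<lambda>_. 1) \<in> Obs \<and>
     (\<forall>u\<in>Obs. continuous_on UNIV u) \<and>
     (\<forall>p\<in>Den. continuous_on UNIV p \<and> integrable lborel p) \<and>
     (\<forall>u\<in>Obs. \<forall>p\<in>Den. integrable lborel (\<lambda>z. u z * p z))"

definition complete_wrt :: "(('a \<Rightarrow> complex) \<Rightarrow> real) \<Rightarrow> ('a \<Rightarrow> complex) set \<Rightarrow> bool" where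
  "complete_wrt N V \<longleftrightarrow>
     (\<forall>s :: nat \<Rightarrow> 'a \<Rightarrow> complex.
        (\<forall>k. s k \<in> V) \<and> (\<forall>e>0. \<exists>k0. \<forall>j\<ge>k0. \<forall>k\<ge>k0. N (s j - s k) < e)
        \<longrightarrow> (\<exists>u\<in>V. (\<lambda>k. N (s k - u)) \<longlonglongrightarrow> 0))"

text \<open>
  \<open>N\<close> makes \<open>Obs\<close> a Banach space in which convergence is stronger than uniform
  convergence on compact sets, and in which integration against an element of \<open>Den\<close> is
  continuous.
\<close>

definition banach_observables ::
    "('a::euclidean_space \<Rightarrow> complex) set \<Rightarrow> (('a \<Rightarrow> complex) \<Rightarrow> real) \<Rightarrow> ('a \<Rightarrow> complex) set \<Rightarrow> bool" where
  "banach_observables Obs N Den \<longleftrightarrow>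
     (\<forall>u\<in>Obs. 0 \<le> N u) \<and>
     (\<forall>u\<in>Obs. \<forall>c. N (cscale c u) = cmod c * N u) \<and>
     (\<forall>u\<in>Obs. \<forall>w\<in>Obs. N (u + w) \<le> N u + N w) \<and>
     (\<forall>K. compact K \<longrightarrow> (\<exists>C. \<forall>u\<in>Obs. \<forall>z\<in>K. cmod (u z) \<le> C * N u)) \<and>
     (\<forall>p\<in>Den. \<exists>C. \<forall>u\<in>Obs. cmod (pairing u p) \<le> C * N u) \<and>
     complete_wrt N Obs"

definition C2_domain :: "('a::euclidean_space \<Rightarrow> complex) set
    \<Rightarrow> (('a \<Rightarrow> complex) \<Rightarrow> ('a \<Rightarrow> complex)) set \<Rightarrow> ('a \<Rightarrow> complex) set" where
  "C2_domain V Ls = {u \<in> V. C2_fun u \<and> (\<forall>L\<in>Ls. L u \<in> V)}"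

definition formally_adjoint ::
    "(('a::euclidean_space \<Rightarrow> complex) \<Rightarrow> ('a \<Rightarrow> complex)) \<Rightarrow> ('a \<Rightarrow> complex) set
     \<Rightarrow> (('a \<Rightarrow> complex) \<Rightarrow> ('a \<Rightarrow> complex)) \<Rightarrow> ('a \<Rightarrow> complex) set \<Rightarrow> bool" where
  "formally_adjoint Lb E Lf F \<longleftrightarrow> (\<forall>u\<in>E. \<forall>p\<in>F. pairing (Lb u) p = pairing u (Lf p))"

definition bdom1 where
  "bdom1 f g Obs = C2_domain Obs {bwd_osc f g}"

definition fdom1 where
  "fdom1 f g Den = C2_domain Den {fwd_osc f g}"

definition bdom :: "('n::finite, 'm::finite) oscillators \<Rightarrow> 'n joint set \<Rightarrow> 'n joint set" where
  "bdom S Obs = C2_domain Obs {(\<lambda>u. bwd_x S u + bwd_y S u), bwd_tau S, bwd_kappa S}"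

definition fdom :: "('n::finite, 'm::finite) oscillators \<Rightarrow> 'n joint set \<Rightarrow> 'n joint set" where
  "fdom S Den = C2_domain Den {(\<lambda>p. fwd_x S p + fwd_y S p), fwd_tau S, fwd_kappa S}"

definition graph_norm :: "('n::finite, 'm::finite) oscillators \<Rightarrow> ('n joint \<Rightarrow> real) \<Rightarrow> 'n joint \<Rightarrow> real" where
  "graph_norm S N u = N u + N (bwd_x S u + bwd_y S u) + N (bwd_tau S u) + N (bwd_kappa S u)"

definition L1_norm :: "('a::euclidean_space \<Rightarrow> complex) \<Rightarrow> real" where
  "L1_norm p = (\<integral>z. cmod (p z) \<partial>lborel)"

text \<open>
  Standing assumptions on the spaces: \<open>Obs\<^sub>1, Den\<^sub>1\<close> for an isolated oscillator,
  \<open>Obs, Den\<close> for the joint system. Completeness of the domain in the graph norm is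
  closedness of the backward operators.
\<close>

definition function_spaces ::
    "('n::finite, 'm::finite) oscillators \<Rightarrow> (real^'n \<Rightarrow> complex) set \<Rightarrow> (real^'n \<Rightarrow> complex) set
     \<Rightarrow> 'n joint set \<Rightarrow> ('n joint \<Rightarrow> real) \<Rightarrow> 'n joint set \<Rightarrow> bool" where
  "function_spaces S Obs\<^sub>1 Den\<^sub>1 Obs N Den \<longleftrightarrow>
     dual_spaces Obs\<^sub>1 Den\<^sub>1 \<and>
     (\<forall>g\<in>{noise_x S, noise_y S}.
        formally_adjoint (bwd_osc (drift S) g) (bdom1 (drift S) g Obs\<^sub>1)
                         (fwd_osc (drift S) g) (fdom1 (drift S) g Den\<^sub>1)) \<and>
     dual_spaces Obs Den \<and> banach_observables Obs N Den \<and>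
     complete_wrt (graph_norm S N) (bdom S Obs) \<and>
     (\<forall>\<kappa> \<tau>. formally_adjoint (bwd S \<kappa> \<tau>) (bdom S Obs) (fwd S \<kappa> \<tau>) (fdom S Den))"

section \<open>Spectral notions\<close>

definition eigenspace :: "(('a \<Rightarrow> complex) \<Rightarrow> ('a \<Rightarrow> complex)) \<Rightarrow> ('a \<Rightarrow> complex) set \<Rightarrow> complex
    \<Rightarrow> ('a \<Rightarrow> complex) set" where
  "eigenspace L D z = {u \<in> D. L u = cscale z u}"

definition eigenvalues :: "(('a \<Rightarrow> complex) \<Rightarrow> ('a \<Rightarrow> complex)) \<Rightarrow> ('a \<Rightarrow> complex) set \<Rightarrow> complex set" where
  "eigenvalues L D = {z. \<exists>u\<in>eigenspace L D z. u \<noteq> 0}"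

definition discrete_eigenvalues ::
    "(('a \<Rightarrow> complex) \<Rightarrow> ('a \<Rightarrow> complex)) \<Rightarrow> ('a \<Rightarrow> complex) set \<Rightarrow> bool" where
  "discrete_eigenvalues L D \<longleftrightarrow> discrete (eigenvalues L D) \<and> \<not> 0 islimpt eigenvalues L D"

definition complete_biorthonormal ::
    "(('a::euclidean_space \<Rightarrow> complex) \<Rightarrow> ('a \<Rightarrow> complex)) \<Rightarrow> ('a \<Rightarrow> complex) set
     \<Rightarrow> (('a \<Rightarrow> complex) \<Rightarrow> ('a \<Rightarrow> complex)) \<Rightarrow> ('a \<Rightarrow> complex) set \<Rightarrow> bool" where
  "complete_biorthonormal Lb E Lf F \<longleftrightarrow>
     (\<exists>(I :: nat set) z q p.
        (\<forall>k\<in>I. q k \<in> eigenspace Lb E (z k) \<and> p k \<in> eigenspace Lf F (z k)) \<and>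
        (\<forall>j\<in>I. \<forall>k\<in>I. pairing (q j) (p k) = (if j = k then 1 else 0)) \<and>
        (\<forall>u\<in>E. (\<forall>k\<in>I. pairing u (p k) = 0) \<longrightarrow> u = 0) \<and>
        (\<forall>w\<in>F. (\<forall>k\<in>I. pairing (q k) w = 0) \<longrightarrow> w = 0))"

text \<open>
  \<open>L\<close> acts from its domain \<open>D\<close> into \<open>R\<close>; \<open>Ld\<close> with domain
  \<open>Dd\<close> is its adjoint.
\<close>

definition fredholm_alternative ::
    "(('a::euclidean_space \<Rightarrow> complex) \<Rightarrow> ('a \<Rightarrow> complex)) \<Rightarrow> ('a \<Rightarrow> complex) set \<Rightarrow> ('a \<Rightarrow> complex) set
     \<Rightarrow> (('a \<Rightarrow> complex) \<Rightarrow> ('a \<Rightarrow> complex)) \<Rightarrow> ('a \<Rightarrow> complex) set \<Rightarrow> bool" where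
  "fredholm_alternative L D R Ld Dd \<longleftrightarrow>
     (\<forall>f\<in>R.
        ((\<exists>u\<in>D. L u = f) \<longleftrightarrow> (\<forall>v\<in>Dd. Ld v = 0 \<longrightarrow> pairing f v = 0)) \<and>
        ((\<exists>u\<in>D. L u = f) \<longrightarrow>
           ((\<exists>!u. u \<in> D \<and> L u = f) \<longleftrightarrow> (\<forall>u\<in>D. L u = 0 \<longrightarrow> u = 0))))"

definition probability_density :: "('a::euclidean_space \<Rightarrow> complex) \<Rightarrow> bool" where
  "probability_density P \<longleftrightarrow> (\<forall>z. P z \<in> \<real> \<and> 0 \<le> Re (P z)) \<and> (\<integral>z. P z \<partial>lborel) = 1"

definition unique_stationary ::
    "(('a::euclidean_space \<Rightarrow> complex) \<Rightarrow> ('a \<Rightarrow> complex)) \<Rightarrow> ('a \<Rightarrow> complex) set \<Rightarrow> ('a \<Rightarrow> complex) \<Rightarrow> bool" where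
  "unique_stationary Lf F P \<longleftrightarrow>
     P \<in> F \<and> Lf P = 0 \<and> probability_density P \<and>
     (\<forall>p\<in>F. Lf p = 0 \<and> probability_density p \<longrightarrow> p = P) \<and>
     eigenspace Lf F 0 = cfun.span {P}"

text \<open>
  A quality factor \<open>\<bar>\<omega>/\<mu>\<bar>\<close> much larger than one is rendered by the weakest reading,
  namely that it exceeds one. Uniqueness of the pair is simplicity of both eigenvalues.
\<close>

definition robustly_oscillatory ::
    "(real^'n \<Rightarrow> real^'n) \<Rightarrow> (real^'n \<Rightarrow> real^'m^'n)
     \<Rightarrow> (real^'n \<Rightarrow> complex) set \<Rightarrow> (real^'n \<Rightarrow> complex) set \<Rightarrow> complex \<Rightarrow> bool" where
  "robustly_oscillatory f g Obs\<^sub>1 Den\<^sub>1 \<Lambda>\<^sub>1 \<longleftrightarrow>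
     (let L = bwd_osc f g; E = bdom1 f g Obs\<^sub>1; \<sigma> = eigenvalues L E in
        0 \<in> \<sigma> \<and> (\<forall>z\<in>\<sigma>. z \<noteq> 0 \<longrightarrow> Re z < 0) \<and>
        \<Lambda>\<^sub>1 \<in> \<sigma> \<and> cnj \<Lambda>\<^sub>1 \<in> \<sigma> \<and> Im \<Lambda>\<^sub>1 \<noteq> 0 \<and> 1 < \<bar>Im \<Lambda>\<^sub>1 / Re \<Lambda>\<^sub>1\<bar> \<and>
        (\<exists>q. eigenspace L E \<Lambda>\<^sub>1 = cfun.span {q}) \<and> (\<exists>q. eigenspace L E (cnj \<Lambda>\<^sub>1) = cfun.span {q}) \<and>
        (\<exists>\<upsilon>>0. \<forall>z\<in>\<sigma> - {0, \<Lambda>\<^sub>1, cnj \<Lambda>\<^sub>1}. Re z < Re \<Lambda>\<^sub>1 \<and> Re z < \<upsilon> * Re \<Lambda>\<^sub>1) \<and>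
        (\<exists>P. unique_stationary (fwd_osc f g) (fdom1 f g Den\<^sub>1) P))"

definition unperturbed_criteria ::
    "('n::finite, 'm::finite) oscillators \<Rightarrow> (real^'n \<Rightarrow> complex) set \<Rightarrow> (real^'n \<Rightarrow> complex) set
     \<Rightarrow> 'n joint set \<Rightarrow> 'n joint set \<Rightarrow> complex \<Rightarrow> bool" where
  "unperturbed_criteria S Obs\<^sub>1 Den\<^sub>1 Obs Den \<Lambda>\<^sub>1 \<longleftrightarrow>
     (\<forall>g\<in>{noise_x S, noise_y S}.
        (let Lb = bwd_osc (drift S) g; E = bdom1 (drift S) g Obs\<^sub>1;
             Lf = fwd_osc (drift S) g; F = fdom1 (drift S) g Den\<^sub>1
         in robustly_oscillatory (drift S) g Obs\<^sub>1 Den\<^sub>1 \<Lambda>\<^sub>1 \<and>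
            discrete_eigenvalues Lb E \<and> discrete_eigenvalues Lf F \<and>
            complete_biorthonormal Lb E Lf F)) \<and>
     (let Lb = bwd S 0 0; E = bdom S Obs; Lf = fwd S 0 0; F = fdom S Den
      in discrete_eigenvalues Lb E \<and> discrete_eigenvalues Lf F \<and>
         complete_biorthonormal Lb E Lf F \<and>
         (\<forall>z. fredholm_alternative (\<lambda>u. Lb u - cscale z u) E Obs (\<lambda>p. Lf p - cscale z p) F \<and>
              fredholm_alternative (\<lambda>p. Lf p - cscale z p) F Den (\<lambda>u. Lb u - cscale z u) E))"

section \<open>Smooth dependence on the perturbation strength\<close>

definition C1_path :: "(real \<Rightarrow> complex) \<Rightarrow> bool" where
  "C1_path l \<longleftrightarrow> (\<exists>l'. (\<forall>\<epsilon>\<in>{-1..1}. (l has_vector_derivative l' \<epsilon>) (at \<epsilon> within {-1..1})) \<and>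
     continuous_on {-1..1} l')"

definition C1_family :: "('a \<Rightarrow> complex) set \<Rightarrow> (('a \<Rightarrow> complex) \<Rightarrow> real) \<Rightarrow> (real \<Rightarrow> 'a \<Rightarrow> complex) \<Rightarrow> bool" where
  "C1_family V N q \<longleftrightarrow> (\<exists>q'. \<forall>\<epsilon>\<in>{-1..1}. q \<epsilon> \<in> V \<and> q' \<epsilon> \<in> V \<and>
     ((\<lambda>\<eta>. N (q \<eta> - q \<epsilon> - cscale (of_real (\<eta> - \<epsilon>)) (q' \<epsilon>)) / \<bar>\<eta> - \<epsilon>\<bar>) \<longlongrightarrow> 0) (at \<epsilon> within {-1..1}) \<and>
     ((\<lambda>\<eta>. N (q' \<eta> - q' \<epsilon>)) \<longlongrightarrow> 0) (at \<epsilon> within {-1..1}))"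

text \<open>
  All nonzero eigenvalues of the joint operators at \<open>(\<epsilon>\<kappa>, \<epsilon>\<tau>)\<close>, and their
  backward and forward eigenfunctions, organise into families that are \<open>C\<^sup>1\<close> in
  \<open>\<epsilon>\<close>. Backward eigenfunctions are \<open>C\<^sup>1\<close> for the graph norm of their domain,
  forward ones for the \<open>L\<^sub>1\<close> norm.
\<close>

definition C1_eigenfamilies ::
    "('n::finite, 'm::finite) oscillators \<Rightarrow> 'n joint set \<Rightarrow> ('n joint \<Rightarrow> real) \<Rightarrow> 'n joint set
     \<Rightarrow> real \<Rightarrow> real \<Rightarrow> bool" where
  "C1_eigenfamilies S Obs N Den \<kappa> \<tau> \<longleftrightarrow>
     (\<exists>(I :: nat set) l q p.
        (\<forall>k\<in>I. C1_path (l k) \<and> C1_family (bdom S Obs) (graph_norm S N) (q k) \<and>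
                C1_family Den L1_norm (p k) \<and>
                (\<forall>\<epsilon>\<in>{-1..1}. l k \<epsilon> \<noteq> 0 \<and> q k \<epsilon> \<noteq> 0 \<and> p k \<epsilon> \<noteq> 0)) \<and>
        (\<forall>\<epsilon>\<in>{-1..1}. \<forall>z. z \<noteq> 0 \<longrightarrow>
           eigenspace (bwd S (\<epsilon> * \<kappa>) (\<epsilon> * \<tau>)) (bdom S Obs) z = cfun.span {q k \<epsilon> | k. k \<in> I \<and> l k \<epsilon> = z} \<and>
           eigenspace (fwd S (\<epsilon> * \<kappa>) (\<epsilon> * \<tau>)) (fdom S Den) z = cfun.span {p k \<epsilon> | k. k \<in> I \<and> l k \<epsilon> = z}))"

definition perturbation_criteria ::
    "('n::finite, 'm::finite) oscillators \<Rightarrow> 'n joint set \<Rightarrow> ('n joint \<Rightarrow> real) \<Rightarrow> 'n joint set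
     \<Rightarrow> real set \<Rightarrow> real set \<Rightarrow> bool" where
  "perturbation_criteria S Obs N Den K T \<longleftrightarrow>
     open K \<and> open T \<and> 0 \<in> K \<and> 0 \<in> T \<and>
     (\<forall>\<kappa>\<in>K. \<forall>\<tau>\<in>T.
        (\<exists>P. unique_stationary (fwd S \<kappa> \<tau>) (fdom S Den) P) \<and>
        (\<exists>P. C1_family Den L1_norm P \<and>
             (\<forall>\<epsilon>\<in>{-1..1}. unique_stationary (fwd S (\<epsilon> * \<kappa>) (\<epsilon> * \<tau>)) (fdom S Den) (P \<epsilon>))) \<and>
        C1_eigenfamilies S Obs N Den \<kappa> \<tau>)"

definition coupled_oscillator_criteria where
  "coupled_oscillator_criteria S Obs\<^sub>1 Den\<^sub>1 Obs N Den \<Lambda>\<^sub>1 K T \<longleftrightarrow>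
     unperturbed_criteria S Obs\<^sub>1 Den\<^sub>1 Obs Den \<Lambda>\<^sub>1 \<and> perturbation_criteria S Obs N Den K T"

section \<open>Unperturbed modes\<close>

definition leading_modes ::
    "(real^'n \<Rightarrow> real^'n) \<Rightarrow> (real^'n \<Rightarrow> real^'m^'n)
     \<Rightarrow> (real^'n \<Rightarrow> complex) set \<Rightarrow> (real^'n \<Rightarrow> complex) set \<Rightarrow> complex
     \<Rightarrow> (real^'n \<Rightarrow> complex) \<Rightarrow> (real^'n \<Rightarrow> complex) \<Rightarrow> (real^'n \<Rightarrow> complex) \<Rightarrow> bool" where
  "leading_modes f g Obs\<^sub>1 Den\<^sub>1 \<Lambda>\<^sub>1 P\<^sub>0 Q\<^sub>1 P\<^sub>1 \<longleftrightarrow>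
     unique_stationary (fwd_osc f g) (fdom1 f g Den\<^sub>1) P\<^sub>0 \<and>
     Q\<^sub>1 \<in> eigenspace (bwd_osc f g) (bdom1 f g Obs\<^sub>1) \<Lambda>\<^sub>1 \<and>
     P\<^sub>1 \<in> eigenspace (fwd_osc f g) (fdom1 f g Den\<^sub>1) \<Lambda>\<^sub>1 \<and>
     pairing Q\<^sub>1 P\<^sub>1 = 1 \<and>
     integrable lborel (\<lambda>x. (cmod (Q\<^sub>1 x))\<^sup>2 * Re (P\<^sub>0 x)) \<and>
     (\<integral>x. (cmod (Q\<^sub>1 x - pairing Q\<^sub>1 P\<^sub>0))\<^sup>2 * Re (P\<^sub>0 x) \<partial>lborel) = 1"

definition mode_x :: "('a \<Rightarrow> complex) \<Rightarrow> 'a \<times> 'a \<Rightarrow> complex" where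
  "mode_x Q\<^sub>1 = (\<lambda>(x, y). Q\<^sub>1 x)"

definition mode_y :: "('a \<Rightarrow> complex) \<Rightarrow> 'a \<times> 'a \<Rightarrow> complex" where
  "mode_y Q\<^sub>1 = (\<lambda>(x, y). Q\<^sub>1 y)"

definition fmode_x :: "('a \<Rightarrow> complex) \<Rightarrow> ('a \<Rightarrow> complex) \<Rightarrow> 'a \<times> 'a \<Rightarrow> complex" where
  "fmode_x P\<^sub>0 P\<^sub>1 = (\<lambda>(x, y). P\<^sub>1 x * P\<^sub>0 y)"

definition fmode_y :: "('a \<Rightarrow> complex) \<Rightarrow> ('a \<Rightarrow> complex) \<Rightarrow> 'a \<times> 'a \<Rightarrow> complex" where
  "fmode_y P\<^sub>0 P\<^sub>1 = (\<lambda>(x, y). P\<^sub>1 y * P\<^sub>0 x)"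

definition multiplicity_two ::
    "('n::finite, 'm::finite) oscillators \<Rightarrow> 'n joint set \<Rightarrow> 'n joint set \<Rightarrow> complex
     \<Rightarrow> (real^'n \<Rightarrow> complex) \<Rightarrow> (real^'n \<Rightarrow> complex) \<Rightarrow> (real^'n \<Rightarrow> complex) \<Rightarrow> bool" where
  "multiplicity_two S Obs Den \<Lambda>\<^sub>1 P\<^sub>0 Q\<^sub>1 P\<^sub>1 \<longleftrightarrow>
     eigenspace (bwd S 0 0) (bdom S Obs) \<Lambda>\<^sub>1 = cfun.span {mode_x Q\<^sub>1, mode_y Q\<^sub>1} \<and>
     eigenspace (fwd S 0 0) (fdom S Den) \<Lambda>\<^sub>1 = cfun.span {fmode_x P\<^sub>0 P\<^sub>1, fmode_y P\<^sub>0 P\<^sub>1}"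

definition coupling_matrix ::
    "('n::finite, 'm::finite) oscillators \<Rightarrow> (real^'n \<Rightarrow> complex) \<Rightarrow> (real^'n \<Rightarrow> complex)
     \<Rightarrow> (real^'n \<Rightarrow> complex) \<Rightarrow> real \<Rightarrow> real \<Rightarrow> complex^2^2" where
  "coupling_matrix S P\<^sub>0 Q\<^sub>1 P\<^sub>1 \<kappa> \<tau> =
     (let Q\<^sub>1\<^sub>x = mode_x Q\<^sub>1; Q\<^sub>1\<^sub>y = mode_y Q\<^sub>1; P\<^sub>1\<^sub>x = fmode_x P\<^sub>0 P\<^sub>1; P\<^sub>1\<^sub>y = fmode_y P\<^sub>0 P\<^sub>1;
          L = bwd_perturbation S \<kappa> \<tau>
      in vector [vector [pairing (L Q\<^sub>1\<^sub>x) P\<^sub>1\<^sub>x, pairing (L Q\<^sub>1\<^sub>y) P\<^sub>1\<^sub>x],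
                 vector [pairing (L Q\<^sub>1\<^sub>x) P\<^sub>1\<^sub>y, pairing (L Q\<^sub>1\<^sub>y) P\<^sub>1\<^sub>y]])"

definition combination :: "('a \<Rightarrow> complex) \<Rightarrow> complex^2 \<Rightarrow> 'a \<times> 'a \<Rightarrow> complex" where
  "combination Q\<^sub>1 v = cscale (v $ 1) (mode_x Q\<^sub>1) + cscale (v $ 2) (mode_y Q\<^sub>1)"

text \<open>
  By biorthonormality, the coordinates of the spectral projection of \<open>u\<close> onto the
  unperturbed two-dimensional eigenspace.
\<close>

definition mode_coordinates :: "(real^'n \<Rightarrow> complex) \<Rightarrow> (real^'n \<Rightarrow> complex) \<Rightarrow> 'n joint \<Rightarrow> complex^2" where
  "mode_coordinates P\<^sub>0 P\<^sub>1 u = vector [pairing u (fmode_x P\<^sub>0 P\<^sub>1), pairing u (fmode_y P\<^sub>0 P\<^sub>1)]"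

section \<open>Perturbed modes\<close>

datatype sign = Upper | Lower

definition diagonalized_by :: "complex^2^2 \<Rightarrow> (sign \<Rightarrow> complex) \<Rightarrow> (sign \<Rightarrow> complex^2) \<Rightarrow> bool" where
  "diagonalized_by M \<Lambda>\<^sub>c v \<longleftrightarrow>
     (\<forall>s. M *v v s = \<Lambda>\<^sub>c s *s v s) \<and> v Upper \<noteq> v Lower \<and> vec.independent {v Upper, v Lower}"

text \<open>
  Two eigenpair families are the same if they differ only in the naming of the signs and the
  scaling of the eigenvectors (when the eigenvalues coincide, in the choice of a basis).
\<close>

definition same_eigenpairs ::
    "(sign \<Rightarrow> complex) \<Rightarrow> (sign \<Rightarrow> complex^2) \<Rightarrow> (sign \<Rightarrow> complex) \<Rightarrow> (sign \<Rightarrow> complex^2) \<Rightarrow> bool" where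
  "same_eigenpairs \<Lambda>\<^sub>c v \<Lambda>\<^sub>c' v' \<longleftrightarrow>
     (\<exists>\<pi>. bij \<pi> \<and> (\<forall>s. \<Lambda>\<^sub>c' s = \<Lambda>\<^sub>c (\<pi> s) \<and>
        (\<Lambda>\<^sub>c Upper \<noteq> \<Lambda>\<^sub>c Lower \<longrightarrow> (\<exists>a. a \<noteq> 0 \<and> v' s = a *s v (\<pi> s)))))"

definition first_correction ::
    "('n::finite, 'm::finite) oscillators \<Rightarrow> 'n joint set \<Rightarrow> complex
     \<Rightarrow> (real^'n \<Rightarrow> complex) \<Rightarrow> (real^'n \<Rightarrow> complex) \<Rightarrow> (real^'n \<Rightarrow> complex)
     \<Rightarrow> real \<Rightarrow> real \<Rightarrow> complex \<Rightarrow> complex^2 \<Rightarrow> 'n joint \<Rightarrow> bool" where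
  "first_correction S Obs \<Lambda>\<^sub>1 P\<^sub>0 Q\<^sub>1 P\<^sub>1 \<kappa> \<tau> \<Lambda>\<^sub>c v Q\<^sub>c \<longleftrightarrow>
     Q\<^sub>c \<in> bdom S Obs \<and>
     bwd_x S Q\<^sub>c + bwd_y S Q\<^sub>c - cscale \<Lambda>\<^sub>1 Q\<^sub>c
       = - (bwd_perturbation S \<kappa> \<tau> (combination Q\<^sub>1 v) - cscale \<Lambda>\<^sub>c (combination Q\<^sub>1 v)) \<and>
     pairing Q\<^sub>c (fmode_x P\<^sub>0 P\<^sub>1) = 0 \<and> pairing Q\<^sub>c (fmode_y P\<^sub>0 P\<^sub>1) = 0"

text \<open>
  \<open>Q s \<epsilon>\<close> and \<open>l s \<epsilon>\<close> are the perturbed eigenfunction and eigenvalue with sign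
  \<open>s\<close> at \<open>(\<epsilon>\<kappa>, \<epsilon>\<tau>)\<close>. They are functions of \<open>\<epsilon>\<close> for a fixed direction
  \<open>(\<kappa>, \<tau>)\<close> because their limits at \<open>\<epsilon> = 0\<close> depend on the direction.
\<close>

definition perturbed_modes ::
    "('n::finite, 'm::finite) oscillators \<Rightarrow> 'n joint set \<Rightarrow> ('n joint \<Rightarrow> real) \<Rightarrow> complex
     \<Rightarrow> real \<Rightarrow> real \<Rightarrow> (sign \<Rightarrow> real \<Rightarrow> 'n joint) \<Rightarrow> (sign \<Rightarrow> real \<Rightarrow> complex) \<Rightarrow> bool" where
  "perturbed_modes S Obs N \<Lambda>\<^sub>1 \<kappa> \<tau> Q l \<longleftrightarrow>
     (\<forall>s. C1_path (l s) \<and> C1_family (bdom S Obs) (graph_norm S N) (Q s) \<and> l s 0 = \<Lambda>\<^sub>1 \<and>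
          (\<forall>\<epsilon>\<in>{-1..1}. Q s \<epsilon> \<noteq> 0 \<and>
             Q s \<epsilon> \<in> eigenspace (bwd S (\<epsilon> * \<kappa>) (\<epsilon> * \<tau>)) (bdom S Obs) (l s \<epsilon>))) \<and>
     cfun.span {Q Upper 0, Q Lower 0} = eigenspace (bwd S 0 0) (bdom S Obs) \<Lambda>\<^sub>1"

text \<open>
  Normalization of a family of perturbed eigenfunctions: up to \<open>O(\<epsilon>\<^sup>2)\<close>, its
  component in the unperturbed eigenspace keeps its value \<open>v\<close>. This is the part of
  the expansion \<open>v\<^sub>1 Q\<^sub>1\<^sub>x + v\<^sub>2 Q\<^sub>1\<^sub>y + \<epsilon> Q\<^sub>c + O(\<epsilon>\<^sup>2)\<close> with \<open>Q\<^sub>c\<close>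
  orthogonal to the forward modes that the eigenvalue equation at first order leaves open.
\<close>

definition normalized_at where
  "normalized_at P\<^sub>0 P\<^sub>1 v q \<longleftrightarrow>
     (\<lambda>\<epsilon>::real. norm (mode_coordinates P\<^sub>0 P\<^sub>1 (q \<epsilon>) - v)) \<in> O[at 0](\<lambda>\<epsilon>. \<epsilon>\<^sup>2)"

end

theory Submission
  imports Defs
begin

text \<open>
  Projecting the eigenvalue equation onto the unperturbed eigenspace by means of the forward modes
  gives \<open>(\<lambda>(\<epsilon>) - \<Lambda>\<^sub>1) a(\<epsilon>) = \<epsilon> M a(\<epsilon>) + O(\<epsilon>\<^sup>2)\<close> for the mode
  coordinates \<open>a(\<epsilon>)\<close> of the perturbed eigenfunction, so its limit is an eigenvector of the
  coupling matrix \<open>M\<close> and the derivative of the eigenvalue is the corresponding eigenvalue of \<open>M\<close>.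
  The remaining part of the eigenfunction, minus \<open>\<epsilon>\<close> times the first correction, is mapped by
  the unperturbed operator minus \<open>\<Lambda>\<^sub>1\<close> to a function of size \<open>O(\<epsilon>\<^sup>2)\<close>. The Fredholm
  alternative makes this operator a bijection between the functions orthogonal to the forward modes,
  and its inverse is bounded by the Baire category theorem. Hence \<open>C\<^sup>1\<close> dependence on
  \<open>\<epsilon>\<close> suffices for remainders of second order.
\<close>

text \<open>No bound on the inverse is assumed, and the eigenfunctions are only C1 in \<epsilon>, so
  a second-order Taylor expansion is out of reach. Nor is any equation differentiated: the
  eigenvalue equation at \<epsilon> is compared with the one at 0, and each error term is either a
  product of two first-order quantities or contains the eigenvalue remainder, which has been
  estimated before. The inverse must be bounded into the graph norm rather than into
  \<open>N\<close>, because the remainder is measured there; this is what completeness of the domain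
  in the graph norm provides. Degeneracy shapes the rest. The prescribed eigenvectors
  \<open>v\<close> need not be the ones from which the smooth families emanate, so the families
  supply their own eigenpairs of \<open>M\<close>, which are then matched with the prescribed ones
  by \<open>same_eigenpairs\<close>. Moreover, multiplying a family by a nonvanishing C1 factor of
  \<epsilon> gives another family of eigenfunctions. The remainder is therefore measured first from
  the combination with the current coordinates a(\<epsilon>), and from the fixed combination only
  under \<open>normalized_at\<close>.\<close>

section \<open>Bounded inverses\<close>

text \<open>
  As simplification rules these turn sums of functions into eta-expanded form, on which the vector
  space lemmas no longer match.
\<close>

lemmas pointwise = plus_fun_apply minus_apply uminus_apply zero_fun_apply

declare pointwise [simp del]

text \<open>The norm is a function on a carrier set because \<open>Obs\<close> and the domain of the
  operators are arbitrary sets of functions. The locale serves both \<open>Obs\<close> with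
  \<open>N\<close> and the domain with the graph norm. Definiteness is split off into the next
  locale, where it makes limits unique.\<close>

locale seminormed_functions =
  fixes V :: "('a \<Rightarrow> complex) set" and N :: "('a \<Rightarrow> complex) \<Rightarrow> real"
  assumes subspace: "cfun.subspace V"
    and norm_nonneg: "u \<in> V \<Longrightarrow> 0 \<le> N u"
    and scale: "u \<in> V \<Longrightarrow> N (cscale c u) = cmod c * N u"
    and add_le: "u \<in> V \<Longrightarrow> w \<in> V \<Longrightarrow> N (u + w) \<le> N u + N w"
begin

lemma zero_mem [simp]: "0 \<in> V"
  and add_mem [simp]: "u \<in> V \<Longrightarrow> w \<in> V \<Longrightarrow> u + w \<in> V"
  and scale_mem [simp]: "u \<in> V \<Longrightarrow> cscale c u \<in> V"
  and diff_mem [simp]: "u \<in> V \<Longrightarrow> w \<in> V \<Longrightarrow> u - w \<in> V"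
  and sum_mem: "(\<And>i. i \<in> I \<Longrightarrow> w' i \<in> V) \<Longrightarrow> sum w' I \<in> V"
  using subspace cfun.subspace_0 cfun.subspace_add cfun.subspace_scale cfun.subspace_diff
    cfun.subspace_sum by blast+

lemma norm_zero [simp]: "N 0 = 0"
  using scale[of 0 0] by simp

lemma diff_commute: "u \<in> V \<Longrightarrow> w \<in> V \<Longrightarrow> N (u - w) = N (w - u)"
proof -
  assume "u \<in> V" "w \<in> V"
  moreover have "u - w = cscale (-1) (w - u)" by (simp add: cscale_def fun_eq_iff pointwise)
  ultimately show ?thesis using scale[of "w - u" "-1"] by simp
qed

lemma diff_le: "u \<in> V \<Longrightarrow> w \<in> V \<Longrightarrow> N (u - w) \<le> N u + N w"
  using add_le[of u "0 - w"] diff_mem[of 0 w] diff_commute[of 0 w] by simp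

lemma diff_triangle: "u \<in> V \<Longrightarrow> w \<in> V \<Longrightarrow> z \<in> V \<Longrightarrow> N (u - z) \<le> N (u - w) + N (w - z)"
  using add_le[of "u - w" "w - z"] by simp

lemma le_add_diff: "u \<in> V \<Longrightarrow> w \<in> V \<Longrightarrow> N u \<le> N w + N (u - w)"
  using add_le[of w "u - w"] by simp

lemma sum_le: "(\<And>i. i \<in> I \<Longrightarrow> w i \<in> V) \<Longrightarrow> N (sum w I) \<le> (\<Sum>i\<in>I. N (w i))"
proof (induction I rule: infinite_finite_induct)
  case (insert i I)
  then show ?case using add_le[of "w i" "sum w I"] by (simp add: sum_mem)
qed auto

end

locale complete_normed_functions = seminormed_functions +
  assumes definite: "u \<in> V \<Longrightarrow> N u = 0 \<Longrightarrow> u = 0"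
    and complete: "complete_wrt N V"
begin

text \<open>The value 0 outside \<open>V\<close> is there because \<open>Metric_space\<close>
  demands nonnegativity and symmetry of all arguments, also of those outside the carrier.\<close>

definition metric :: "('a \<Rightarrow> complex) \<Rightarrow> ('a \<Rightarrow> complex) \<Rightarrow> real" where
  "metric u w = (if u \<in> V \<and> w \<in> V then N (u - w) else 0)"

sublocale Metric_space V metric
proof
  fix u w z assume "u \<in> V" "w \<in> V" "z \<in> V"
  then show "metric u z \<le> metric u w + metric w z"
    by (simp add: metric_def diff_triangle)
next
  fix u w assume "u \<in> V" "w \<in> V"
  then show "metric u w = 0 \<longleftrightarrow> u = w"
    using definite[of "u - w"] by (auto simp: metric_def)
qed (auto simp: metric_def norm_nonneg diff_commute)

lemma mcomplete: mcomplete
  unfolding mcomplete_def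
proof (intro allI impI)
  fix \<sigma> assume \<sigma>: "MCauchy \<sigma>"
  then have V: "\<sigma> k \<in> V" for k by (auto simp: MCauchy_def)
  have "\<exists>k0. \<forall>j\<ge>k0. \<forall>k\<ge>k0. N (\<sigma> j - \<sigma> k) < e" if "e > 0" for e
    using \<sigma> that V unfolding MCauchy_def metric_def by simp
  then obtain u where u: "u \<in> V" "(\<lambda>k. N (\<sigma> k - u)) \<longlonglongrightarrow> 0"
    using complete V unfolding complete_wrt_def by metis
  have "limitin mtopology \<sigma> u sequentially"
    using u V by (simp add: limitin_metric_dist_null metric_def)
  then show "\<exists>u. limitin mtopology \<sigma> u sequentially" by blast
qed

text \<open>Baire category: if the closures of all \<open>S n\<close> had empty interior, so would
  their union, which is the whole nonempty space. Hence some closure contains a ball, in which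
  \<open>S n\<close> is dense.\<close>

lemma countable_cover_somewhere_dense:
  assumes "V = (\<Union>n::nat. S n)"
  obtains n f r where "f \<in> V" "r > 0"
    "\<And>g e. g \<in> V \<Longrightarrow> N (g - f) < r \<Longrightarrow> e > 0 \<Longrightarrow> \<exists>s\<in>S n. N (g - s) < e"
proof -
  have sub: "S n \<subseteq> V" for n using assms by blast
  define cl where "cl n = mtopology closure_of (S n)" for n
  have "\<exists>n. mtopology interior_of (cl n) \<noteq> {}"
  proof (rule ccontr)
    assume "\<nexists>n. mtopology interior_of (cl n) \<noteq> {}"
    then have *: "mtopology interior_of \<Union>(range cl) = {}"
      by (intro metric_Baire_category_alt mcomplete) (auto simp: cl_def)
    have "S n \<subseteq> cl n" for n using sub by (simp add: cl_def closure_of_subset)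
    moreover have "cl n \<subseteq> V" for n
      using closure_of_subset_topspace[of mtopology] by (simp add: cl_def)
    ultimately have "\<Union>(range cl) = V" using assms by blast
    then show False using * interior_of_topspace[of mtopology] zero_mem by auto
  qed
  then obtain n f r where f: "f \<in> V" "r > 0" "mball f r \<subseteq> cl n"
    by (auto simp: metric_interior_of)
  show thesis
  proof (rule that[of f r n])
    fix g e assume "g \<in> V" "N (g - f) < r" "(e::real) > 0"
    then have "g \<in> cl n" using f by (auto simp: metric_def diff_commute)
    then show "\<exists>s\<in>S n. N (g - s) < e"
      using \<open>e > 0\<close> by (fastforce simp: cl_def metric_closure_of metric_def)
  qed (use f in auto)
qed

end

definition linear_on :: "('a \<Rightarrow> complex) set \<Rightarrow> (('a \<Rightarrow> complex) \<Rightarrow> ('b \<Rightarrow> complex)) \<Rightarrow> bool" where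
  "linear_on E A \<longleftrightarrow> (\<forall>u\<in>E. \<forall>w\<in>E. A (u + w) = A u + A w) \<and> (\<forall>c. \<forall>u\<in>E. A (cscale c u) = cscale c (A u))"

lemma linear_onD:
  assumes "linear_on E A"
  shows "u \<in> E \<Longrightarrow> w \<in> E \<Longrightarrow> A (u + w) = A u + A w"
    and "u \<in> E \<Longrightarrow> A (cscale c u) = cscale c (A u)"
  using assms by (auto simp: linear_on_def)

lemma linear_on_diff:
  assumes "linear_on E A" "cfun.subspace E" "u \<in> E" "w \<in> E"
  shows "A (u - w) = A u - A w"
proof -
  have "A ((u - w) + w) = A (u - w) + A w"
    using assms cfun.subspace_diff by (intro linear_onD(1)) auto
  then show ?thesis by (simp add: algebra_simps)
qed

lemma linear_on_zero: "linear_on E A \<Longrightarrow> cfun.subspace E \<Longrightarrow> A 0 = 0"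
  using linear_on_diff[of E A 0 0] cfun.subspace_0 by force

lemma linear_on_sum:
  assumes "linear_on E A" "cfun.subspace E" "\<And>i. i \<in> I \<Longrightarrow> w i \<in> E"
  shows "A (sum w I) = (\<Sum>i\<in>I. A (w i))"
  using assms(3)
proof (induction I rule: infinite_finite_induct)
  case (insert i I)
  then show ?case
    using linear_onD(1)[OF assms(1), of "w i" "sum w I"] cfun.subspace_sum[OF assms(2), of I w] by simp
qed (auto simp: linear_on_zero[OF assms(1,2)])

lemma geometric_decay:
  fixes a :: "nat \<Rightarrow> real"
  assumes "\<And>k. a (Suc k) \<le> a k / 2"
  shows "a k \<le> a 0 * (1/2) ^ k"
proof (induction k)
  case (Suc k)
  then show ?case using assms[of k] by simp
qed simp

lemma sum_half_powers: "i \<le> j \<Longrightarrow> (\<Sum>k\<in>{i..<j}. (1/2::real) ^ k) = 2 * (1/2) ^ i - 2 * (1/2) ^ j"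
  by (induction j rule: dec_induct) auto

text \<open>The open mapping theorem. The images of the \<open>G\<close>-balls of integer radius
  cover \<open>F\<close>, so one of them is dense in some ball. Translating and scaling that ball
  solves \<open>A u = f\<close> up to half the size of \<open>f\<close>, and iterating removes the
  error. Completeness of \<open>F\<close> feeds the category argument, completeness of
  \<open>E\<close> the convergence of the iteration.\<close>

lemma bounded_inverse:
  fixes E :: "('a \<Rightarrow> complex) set" and F :: "('b \<Rightarrow> complex) set"
  assumes "seminormed_functions E G" and complete: "complete_wrt G E"
    and "complete_normed_functions F N"
    and A: "linear_on E A" "A ` E = F"
    and bounded: "\<And>u. u \<in> E \<Longrightarrow> N (A u) \<le> C * G u"
    and inj: "\<And>u. u \<in> E \<Longrightarrow> A u = 0 \<Longrightarrow> u = 0"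
  shows "\<exists>C'. \<forall>u\<in>E. G u \<le> C' * N (A u)"
proof -
  interpret E: seminormed_functions E G by fact
  interpret F: complete_normed_functions F N by fact
  have AF: "A u \<in> F" if "u \<in> E" for u using A(2) that by blast
  note Adiff = linear_on_diff[OF A(1) E.subspace]
  have cover: "F = (\<Union>n. A ` {u \<in> E. G u \<le> real n})"
    unfolding A(2)[symmetric] using real_arch_simple by blast
  obtain n f\<^sub>0 r where f\<^sub>0: "f\<^sub>0 \<in> F" "r > 0" and
    dense: "\<And>g e. g \<in> F \<Longrightarrow> N (g - f\<^sub>0) < r \<Longrightarrow> e > 0 \<Longrightarrow> \<exists>s\<in>A ` {u \<in> E. G u \<le> real n}. N (g - s) < e"
    by (rule F.countable_cover_somewhere_dense[OF cover]) (rule that; assumption)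
  have near: "\<exists>u\<in>E. G u \<le> real n \<and> N (g - A u) < e" if "g \<in> F" "N (g - f\<^sub>0) < r" "e > 0" for g e
    using dense[OF that] by blast
  \<comment> \<open>Below, \<open>f\<close> is scaled by r / (2 N f), the preimage found has
    \<open>G\<close> at most 2 n, and undoing the scaling turns this into 4 n / r times
    \<open>N f\<close>.\<close>
  define D where "D = 4 * real n / r"
  have approx: "\<exists>u\<in>E. G u \<le> D * N f \<and> N (f - A u) \<le> N f / 2" if f: "f \<in> F" for f
  proof (cases "N f = 0")
    case True
    then show ?thesis using F.definite[OF f] linear_on_zero[OF A(1) E.subspace]
      by (intro bexI[of _ 0]) auto
  next
    case False
    then have pos: "N f > 0" using F.norm_nonneg[OF f] by simp
    define c where "c = r / (2 * N f)"
    have c: "c > 0" using pos f\<^sub>0 by (simp add: c_def)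
    define g where "g = cscale (of_real c) f"
    have g: "g \<in> F" "N g = r / 2"
      using f pos c by (auto simp: g_def F.scale) (simp add: c_def)
    \<comment> \<open>The dense ball is centred at \<open>f\<^sub>0\<close>, not at 0. Approximating
      both \<open>f\<^sub>0 + g\<close> and \<open>f\<^sub>0\<close> and subtracting moves it to the
      origin; the two errors r / 8 add up to r / 4, half the norm of \<open>g\<close>.\<close>
    have e: "r / 8 > 0" using f\<^sub>0 by simp
    obtain u where u: "u \<in> E" "G u \<le> real n" "N (f\<^sub>0 + g - A u) < r / 8"
      using near[of "f\<^sub>0 + g" "r / 8"] f\<^sub>0 g e by auto
    obtain w where w: "w \<in> E" "G w \<le> real n" "N (f\<^sub>0 - A w) < r / 8"
      using near[of "f\<^sub>0" "r / 8"] f\<^sub>0 g e by auto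
    have eq: "g - A (u - w) = (f\<^sub>0 + g - A u) - (f\<^sub>0 - A w)"
      using u w by (simp add: Adiff)
    have "f\<^sub>0 + g - A u \<in> F" "f\<^sub>0 - A w \<in> F" using u w f\<^sub>0 g AF by auto
    from F.diff_le[OF this] have close: "N (g - A (u - w)) \<le> r / 4"
      unfolding eq using u w by linarith
    define z where "z = cscale (of_real (1 / c)) (u - w)"
    have z: "z \<in> E" using u w by (simp add: z_def)
    have "G z = G (u - w) / c" using u w c by (simp add: z_def E.scale norm_divide)
    also have "\<dots> \<le> 2 * real n / c"
      using E.diff_le[of u w] u w c by (intro divide_right_mono) auto
    also have "\<dots> = D * N f" using pos f\<^sub>0 by (simp add: D_def c_def)
    finally have 1: "G z \<le> D * N f" .
    have "f - A z = cscale (of_real (1 / c)) (g - A (u - w))"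
      using u w c linear_onD(2)[OF A(1) E.diff_mem[OF u(1) w(1)], of "of_real (1 / c)"]
      unfolding z_def g_def cfun.scale_right_diff_distrib[of _ _ "A (u - w)"] by simp
    then have "N (f - A z) = N (g - A (u - w)) / c"
      using u w c g AF by (simp add: F.scale norm_divide)
    also have "\<dots> \<le> (r / 4) / c" using close c by (intro divide_right_mono) auto
    also have "\<dots> = N f / 2" using pos f\<^sub>0 by (simp add: c_def)
    finally show ?thesis using 1 z by blast
  qed
  then obtain B where B: "\<And>f. f \<in> F \<Longrightarrow> B f \<in> E \<and> G (B f) \<le> D * N f \<and> N (f - A (B f)) \<le> N f / 2"
    by metis
  have D: "D \<ge> 0" using f\<^sub>0 by (simp add: D_def)
  have "G u \<le> 2 * D * N (A u)" if u: "u \<in> E" for u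
  proof -
    \<comment> \<open>\<open>f k\<close> is the residual left after k approximate solutions and
      \<open>s k\<close> is their sum. The residuals halve each time, so the increments of
      \<open>s\<close> are dominated by a geometric series; its sum is the factor 2 in the
      bound.\<close>
    define f where "f = rec_nat (A u) (\<lambda>_ g. g - A (B g))"
    have f0: "f 0 = A u" and fS: "f (Suc k) = f k - A (B (f k))" for k by (auto simp: f_def)
    have fF: "f k \<in> F" for k
      by (induction k) (use u B AF in \<open>auto simp: f0 fS\<close>)
    define s where "s k = (\<Sum>i<k. B (f i))" for k
    have sE: "s k \<in> E" for k using B fF unfolding s_def by (intro E.sum_mem) auto
    have As: "A (s k) = A u - f k" for k
    proof (induction k)
      case 0 then show ?case by (simp add: s_def f0 linear_on_zero[OF A(1) E.subspace])
    next
      case (Suc k)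
      have "s (Suc k) = s k + B (f k)" by (simp add: s_def)
      then show ?case using Suc sE B fF by (simp add: linear_onD(1)[OF A(1)] fS)
    qed
    have Nf: "N (f k) \<le> N (A u) * (1/2) ^ k" for k
      using geometric_decay[of "\<lambda>k. N (f k)" k] B fF by (simp add: f0 fS)
    have sdiff: "G (s j - s i) \<le> 2 * D * N (A u) * (1/2) ^ i" if "i \<le> j" for i j
    proof -
      have "s j - s i = (\<Sum>k\<in>{i..<j}. B (f k))"
        using that unfolding s_def by (simp add: lessThan_atLeast0 sum_diff_nat_ivl)
      then have "G (s j - s i) \<le> (\<Sum>k\<in>{i..<j}. G (B (f k)))"
        using B fF by (simp add: E.sum_le)
      also have "\<dots> \<le> (\<Sum>k\<in>{i..<j}. D * N (A u) * (1/2) ^ k)"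
      proof (rule sum_mono)
        fix k
        have "G (B (f k)) \<le> D * N (f k)" using B fF by blast
        also have "\<dots> \<le> D * (N (A u) * (1/2) ^ k)" using D Nf by (intro mult_left_mono)
        finally show "G (B (f k)) \<le> D * N (A u) * (1/2) ^ k" by (simp add: mult.assoc)
      qed
      also have "\<dots> = D * N (A u) * (\<Sum>k\<in>{i..<j}. (1/2) ^ k)" by (simp add: sum_distrib_left)
      also have "(\<Sum>k\<in>{i..<j}. (1/2::real) ^ k) \<le> 2 * (1/2) ^ i"
        using sum_half_powers[OF that] by simp
      finally show ?thesis
        using D F.norm_nonneg[OF AF[OF u]] by (simp add: mult_left_mono mult.assoc mult.left_commute)
    qed
    have tend: "(\<lambda>i. 2 * D * N (A u) * (1/2) ^ i) \<longlonglongrightarrow> 0"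
      by (intro tendsto_mult_right_zero LIMSEQ_power_zero) simp
    have "\<exists>k0. \<forall>j\<ge>k0. \<forall>k\<ge>k0. G (s j - s k) < e" if e: "e > 0" for e
    proof -
      obtain k0 where k0: "\<And>k. k \<ge> k0 \<Longrightarrow> 2 * D * N (A u) * (1/2) ^ k < e"
        using order_tendstoD(2)[OF tend e] by (auto simp: eventually_sequentially)
      have "G (s j - s k) < e" if "j \<ge> k0" "k \<ge> k0" for j k
      proof (cases "k \<le> j")
        case True then show ?thesis using sdiff[of k j] k0[OF that(2)] by linarith
      next
        case False then show ?thesis
          using sdiff[of j k] k0[OF that(1)] E.diff_commute[OF sE sE, of j k] by linarith
      qed
      then show ?thesis by blast
    qed
    then obtain w where w: "w \<in> E" "(\<lambda>k. G (s k - w)) \<longlonglongrightarrow> 0"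
      using complete sE unfolding complete_wrt_def by metis
    \<comment> \<open>The limit \<open>w\<close> of the partial sums solves
      \<open>A w = A u\<close>, since the difference lies below this null sequence; injectivity then
      gives \<open>w = u\<close>, so the bound on the partial sums passes to
      \<open>u\<close>.\<close>
    have "(\<lambda>k. \<bar>C\<bar> * G (s k - w) + N (A u) * (1/2) ^ k) \<longlonglongrightarrow> \<bar>C\<bar> * 0 + 0"
      by (intro tendsto_intros w tendsto_mult_right_zero LIMSEQ_power_zero) simp
    moreover have "N (A u - A w) \<le> \<bar>C\<bar> * G (s k - w) + N (A u) * (1/2) ^ k" for k
    proof -
      have "N (A u - A w) \<le> N (A u - A (s k)) + N (A (s k) - A w)"
        using F.diff_triangle AF u w sE by simp
      also have "A u - A (s k) = f k" by (simp add: As)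
      also have "N (A (s k) - A w) \<le> C * G (s k - w)"
        using bounded[of "s k - w"] sE w by (simp add: Adiff)
      also have "\<dots> \<le> \<bar>C\<bar> * G (s k - w)" using E.norm_nonneg sE w by (intro mult_right_mono) auto
      finally show ?thesis using Nf[of k] by linarith
    qed
    ultimately have "N (A u - A w) \<le> 0" by (intro LIMSEQ_le_const[where X="\<lambda>k. \<bar>C\<bar> * G (s k - w) + N (A u) * (1/2) ^ k"]) auto
    then have "A u - A w = 0"
      using F.norm_nonneg[of "A u - A w"] F.definite[of "A u - A w"] AF u w by simp
    then have uw: "w = u" using inj[of "u - w"] Adiff u w by simp
    have "(\<lambda>k. 2 * D * N (A u) + G (s k - w)) \<longlonglongrightarrow> 2 * D * N (A u) + 0"
      by (intro tendsto_intros w)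
    moreover have "G u \<le> 2 * D * N (A u) + G (s k - w)" for k
      using E.le_add_diff[of w "s k"] E.diff_commute[of w "s k"] sdiff[of 0 k] w sE uw
      by (simp add: s_def)
    ultimately have "G u \<le> 2 * D * N (A u)"
      by (intro LIMSEQ_le_const[where X="\<lambda>k. 2 * D * N (A u) + G (s k - w)"]) auto
    then show ?thesis by simp
  qed
  then show ?thesis by blast
qed

section \<open>Perturbation of a degenerate eigenvalue\<close>

lemma norm_vector_scalar_mult: "norm (c *s v) = cmod c * norm v" for v :: "complex^'k::finite"
  by (simp add: norm_vec_def norm_mult L2_set_right_distrib)

lemma has_vector_derivative_difference_quotient:
  fixes l :: "real \<Rightarrow> complex"
  assumes "(l has_vector_derivative d) (at 0)"
  shows "((\<lambda>x. (l x - l 0) / of_real x) \<longlongrightarrow> d) (at 0)"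
proof -
  have "((\<lambda>x. norm ((l x - l 0) - x *\<^sub>R d) / norm x) \<longlongrightarrow> 0) (at 0)"
    using assms by (simp add: has_vector_derivative_def has_derivative_at)
  moreover have "\<forall>\<^sub>F x in at 0. norm ((l x - l 0) - x *\<^sub>R d) / norm x = norm ((l x - l 0) / of_real x - d)"
    using eventually_at_filter[of "\<lambda>x::real. x \<noteq> 0" 0 UNIV]
  proof (simp, elim eventually_mono)
    fix x :: real assume "x \<noteq> 0"
    then have "(l x - l 0) / of_real x - d = ((l x - l 0) - x *\<^sub>R d) / of_real x"
      by (simp add: scaleR_conv_of_real diff_divide_distrib)
    then show "cmod ((l x - l 0) - x *\<^sub>R d) / \<bar>x\<bar> = cmod ((l x - l 0) / of_real x - d)"
      by (simp add: norm_divide)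
  qed
  ultimately have "((\<lambda>x. norm ((l x - l 0) / of_real x - d)) \<longlongrightarrow> 0) (at 0)"
    by (rule Lim_transform_eventually)
  then show ?thesis by (simp add: LIM_zero_iff tendsto_norm_zero_iff)
qed

lemma seminormed_functions_subspace:
  assumes "seminormed_functions V N" "cfun.subspace U" "U \<subseteq> V"
  shows "seminormed_functions U N"
proof -
  interpret seminormed_functions V N by fact
  show ?thesis using assms(2,3) norm_nonneg scale add_le by unfold_locales (auto, meson subsetD)
qed

text \<open>\<open>coord\<close> stands for the pairings with the forward eigenfunctions:
  \<open>coord_L\<close> records adjointness and \<open>coord_q\<close> biorthonormality.
  \<open>kernel\<close> says that an eigenfunction is determined by its coordinates, and
  \<open>solvable\<close> is the existence half of the Fredholm alternative. \<open>G\<close> plays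
  the role of a graph norm, relative to which \<open>L\<close> and \<open>B\<close> are
  bounded.\<close>

locale degenerate_perturbation =
  X: complete_normed_functions X N + E: seminormed_functions E G
  for X E :: "('a \<Rightarrow> complex) set" and N G :: "('a \<Rightarrow> complex) \<Rightarrow> real" +
  fixes L B :: "('a \<Rightarrow> complex) \<Rightarrow> ('a \<Rightarrow> complex)" and lam :: complex
    and q :: "'k::finite \<Rightarrow> 'a \<Rightarrow> complex" and coord :: "('a \<Rightarrow> complex) \<Rightarrow> complex^'k"
    and C\<^sub>B C\<^sub>c :: real
  assumes E_complete: "complete_wrt G E"
    and E_X: "E \<subseteq> X"
    and L_linear: "linear_on E L" and L_mem: "u \<in> E \<Longrightarrow> L u \<in> X"
    and B_linear: "linear_on E B" and B_mem: "u \<in> E \<Longrightarrow> B u \<in> X"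
    and N_le: "u \<in> E \<Longrightarrow> N u \<le> G u"
    and L_le: "u \<in> E \<Longrightarrow> N (L u) \<le> G u"
    and B_le: "u \<in> E \<Longrightarrow> N (B u) \<le> C\<^sub>B * G u"
    and coord_add: "u \<in> X \<Longrightarrow> w \<in> X \<Longrightarrow> coord (u + w) = coord u + coord w"
    and coord_scale: "u \<in> X \<Longrightarrow> coord (cscale c u) = c *s coord u"
    and coord_le: "u \<in> X \<Longrightarrow> norm (coord u) \<le> C\<^sub>c * N u"
    and coord_L: "u \<in> E \<Longrightarrow> coord (L u) = lam *s coord u"
    and q_mem: "q k \<in> E" and q_eigen: "L (q k) = cscale lam (q k)"
    and coord_q: "coord (q k) = axis k 1"
    and kernel: "u \<in> E \<Longrightarrow> L u = cscale lam u \<Longrightarrow> coord u = 0 \<Longrightarrow> u = 0"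
    and solvable: "f \<in> X \<Longrightarrow> coord f = 0 \<Longrightarrow> \<exists>u\<in>E. L u - cscale lam u = f"
begin

lemma in_X [simp]: "u \<in> E \<Longrightarrow> u \<in> X"
  using E_X by blast

declare L_mem [simp] B_mem [simp] q_mem [simp]

lemmas L_diff = linear_on_diff[OF L_linear E.subspace]
  and B_diff = linear_on_diff[OF B_linear E.subspace]

lemma coord_zero [simp]: "coord 0 = 0"
  using coord_scale[of 0 0] by simp

lemma coord_diff: "u \<in> X \<Longrightarrow> w \<in> X \<Longrightarrow> coord (u - w) = coord u - coord w"
  using coord_add[of "u - w" w] by (simp add: algebra_simps)

lemma coord_sum: "(\<And>i. i \<in> I \<Longrightarrow> w i \<in> X) \<Longrightarrow> coord (sum w I) = (\<Sum>i\<in>I. coord (w i))"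
proof (induction I rule: infinite_finite_induct)
  case (insert i I)
  then have "coord (w i + sum w I) = coord (w i) + (\<Sum>i\<in>I. coord (w i))"
    using coord_add[of "w i" "sum w I"] by (simp add: X.sum_mem)
  then show ?case using insert by simp
qed auto

definition comb :: "complex^'k \<Rightarrow> 'a \<Rightarrow> complex" where
  "comb v = (\<Sum>k\<in>UNIV. cscale (v $ k) (q k))"

text \<open>The compression of \<open>B\<close> to the eigenspace of \<open>lam\<close>, as in
  first-order degenerate perturbation theory; its columns are the images of the
  \<open>q j\<close>.\<close>

definition reduced_matrix :: "complex^'k^'k" where
  "reduced_matrix = (\<chi> i j. coord (B (q j)) $ i)"

lemma comb_mem [simp]: "comb v \<in> E"
  by (simp add: comb_def E.sum_mem)

lemma comb_diff: "comb (v - w) = comb v - comb w"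
  by (simp add: comb_def cfun.scale_left_diff_distrib sum_subtractf)

lemma coord_comb [simp]: "coord (comb v) = v"
  by (simp add: comb_def coord_sum coord_scale coord_q vec_eq_iff axis_def if_distrib cong: if_cong)

lemma L_comb: "L (comb v) = cscale lam (comb v)"
  unfolding comb_def
  by (simp add: linear_on_sum[OF L_linear E.subspace] linear_onD[OF L_linear] q_eigen
      cfun.scale_sum_right mult.commute)

lemma coord_B_comb: "coord (B (comb v)) = reduced_matrix *v v"
  unfolding comb_def
  by (simp add: linear_on_sum[OF B_linear E.subspace] linear_onD[OF B_linear] coord_sum coord_scale
      reduced_matrix_def matrix_vector_mult_def vec_eq_iff mult.commute)

text \<open>Subtracting \<open>comb (coord u)\<close> leaves an eigenfunction with zero coordinates,
  which vanishes by \<open>kernel\<close>. Thus the \<open>q k\<close> span the eigenspace.\<close>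

lemma comb_coord: "u \<in> E \<Longrightarrow> L u = cscale lam u \<Longrightarrow> comb (coord u) = u"
  using kernel[of "u - comb (coord u)"]
  by (simp add: L_diff L_comb cfun.scale_right_diff_distrib coord_diff)

lemma comb_le: "G (comb v) \<le> (\<Sum>k\<in>UNIV. G (q k)) * norm v"
proof -
  have "G (comb v) \<le> (\<Sum>k\<in>UNIV. G (cscale (v $ k) (q k)))"
    unfolding comb_def by (rule E.sum_le) simp
  also have "\<dots> \<le> (\<Sum>k\<in>UNIV. G (q k) * norm v)"
    by (intro sum_mono) (auto simp: E.scale mult.commute[of "cmod _"] intro!: mult_left_mono Finite_Cartesian_Product.norm_nth_le E.norm_nonneg)
  finally show ?thesis by (simp add: sum_distrib_right)
qed

lemma coord_limit:
  assumes "\<And>k. s k \<in> X" "\<And>k. coord (s k) = 0" "u \<in> X" "(\<lambda>k. N (s k - u)) \<longlonglongrightarrow> 0"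
  shows "coord u = 0"
proof -
  have "(\<lambda>k. C\<^sub>c * N (s k - u)) \<longlonglongrightarrow> C\<^sub>c * 0" using assms(4) by (intro tendsto_intros)
  moreover have "norm (coord u) \<le> C\<^sub>c * N (s k - u)" for k
    using coord_le[of "s k - u"] assms by (simp add: coord_diff)
  ultimately have "norm (coord u) \<le> 0"
    by (intro LIMSEQ_le_const[where X = "\<lambda>k. C\<^sub>c * N (s k - u)"]) auto
  then show ?thesis by simp
qed

text \<open>The kernel of \<open>coord\<close> is closed because \<open>coord\<close> is bounded by
  \<open>N\<close>. A second norm \<open>K\<close> dominating \<open>N\<close> lets the same
  argument serve both the space with \<open>N\<close> and the domain with \<open>G\<close>.\<close>

lemma kernel_of_coord_complete:
  assumes V: "V \<subseteq> X" "complete_wrt K V" and le: "\<And>u w. u \<in> V \<Longrightarrow> w \<in> V \<Longrightarrow> 0 \<le> N (u - w) \<and> N (u - w) \<le> K (u - w)"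
  shows "complete_wrt K {u \<in> V. coord u = 0}"
  unfolding complete_wrt_def
proof (intro allI impI)
  fix s :: "nat \<Rightarrow> 'a \<Rightarrow> complex"
  assume *: "(\<forall>k. s k \<in> {u \<in> V. coord u = 0}) \<and> (\<forall>e>0. \<exists>k0. \<forall>j\<ge>k0. \<forall>k\<ge>k0. K (s j - s k) < e)"
  then obtain u where u: "u \<in> V" "(\<lambda>k. K (s k - u)) \<longlonglongrightarrow> 0"
    using V(2)[unfolded complete_wrt_def, rule_format, of s] by blast
  have s: "s k \<in> V" "coord (s k) = 0" for k using * by auto
  have lim: "(\<lambda>k. N (s k - u)) \<longlonglongrightarrow> 0"
    by (rule tendsto_sandwich[OF _ _ tendsto_const u(2)]) (use le u(1) s in auto)
  have X: "s k \<in> X" "u \<in> X" for k using s(1) u(1) V(1) by auto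
  have "coord u = 0" by (rule coord_limit[OF X(1) s(2) X(2) lim])
  then show "\<exists>u\<in>{u \<in> V. coord u = 0}. (\<lambda>k. K (s k - u)) \<longlonglongrightarrow> 0" using u by blast
qed

text \<open>\<open>bounded_inverse\<close> applied to \<open>L - lam\<close> between the kernels of
  \<open>coord\<close> in \<open>E\<close> and in \<open>X\<close>. Adjointness, in the form
  \<open>coord_L\<close>, makes every value of \<open>L - lam\<close> have zero coordinates, so the
  operator maps into the right space.\<close>

lemma shifted_inverse_bounded:
  "\<exists>C\<ge>0. \<forall>u\<in>E. coord u = 0 \<longrightarrow> G u \<le> C * N (L u - cscale lam u)"
proof -
  define E\<^sub>0 where "E\<^sub>0 = {u \<in> E. coord u = 0}"
  define X\<^sub>0 where "X\<^sub>0 = {u \<in> X. coord u = 0}"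
  define A where "A u = L u - cscale lam u" for u
  have sub: "cfun.subspace E\<^sub>0" "cfun.subspace X\<^sub>0"
    by (auto simp: cfun.subspace_def E\<^sub>0_def X\<^sub>0_def coord_add coord_scale)
  have E0: "seminormed_functions E\<^sub>0 G"
    using E.seminormed_functions_axioms sub(1) by (rule seminormed_functions_subspace) (auto simp: E\<^sub>0_def)
  have X0: "seminormed_functions X\<^sub>0 N"
    using X.seminormed_functions_axioms sub(2) by (rule seminormed_functions_subspace) (auto simp: X\<^sub>0_def)
  have E0c: "complete_wrt G E\<^sub>0" unfolding E\<^sub>0_def
    using E_X E_complete by (rule kernel_of_coord_complete) (simp add: N_le X.norm_nonneg)
  have X0c: "complete_wrt N X\<^sub>0" unfolding X\<^sub>0_def
    using X.complete by (intro kernel_of_coord_complete) (auto simp: X.norm_nonneg)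
  interpret X0: complete_normed_functions X\<^sub>0 N
    using X0 X0c X.definite by (auto simp: complete_normed_functions_def complete_normed_functions_axioms_def X\<^sub>0_def)
  have lin: "linear_on E\<^sub>0 A"
    by (auto simp: linear_on_def A_def E\<^sub>0_def linear_onD[OF L_linear] cfun.scale_right_distrib
        cfun.scale_right_diff_distrib mult.commute)
  have coordA: "coord (A u) = 0" if "u \<in> E" for u
    using that by (simp add: A_def coord_diff coord_scale coord_L)
  have img: "A ` E\<^sub>0 = X\<^sub>0"
  proof (intro equalityI subsetI)
    fix f assume "f \<in> A ` E\<^sub>0"
    then show "f \<in> X\<^sub>0" using coordA by (auto simp: E\<^sub>0_def X\<^sub>0_def) (simp add: A_def)
  next
    fix f assume f: "f \<in> X\<^sub>0"
    then obtain u where u: "u \<in> E" "A u = f" using solvable by (auto simp: X\<^sub>0_def A_def)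
    \<comment> \<open>Removing the eigenspace part of a solution does not change its image and moves
      it into the kernel of \<open>coord\<close>.\<close>
    have "A (u - comb (coord u)) = f"
      using u by (simp add: A_def L_diff L_comb cfun.scale_right_diff_distrib)
    moreover have "u - comb (coord u) \<in> E\<^sub>0" using u by (simp add: E\<^sub>0_def coord_diff)
    ultimately show "f \<in> A ` E\<^sub>0" by blast
  qed
  have bd: "N (A u) \<le> (1 + cmod lam) * G u" if "u \<in> E\<^sub>0" for u
  proof -
    have u: "u \<in> E" using that by (simp add: E\<^sub>0_def)
    have "N (A u) \<le> N (L u) + cmod lam * N u"
      using X.diff_le[of "L u" "cscale lam u"] u by (simp add: A_def X.scale)
    also have "\<dots> \<le> G u + cmod lam * G u" using L_le N_le u by (intro add_mono mult_left_mono) auto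
    finally show ?thesis by (simp add: algebra_simps)
  qed
  have inj: "u = 0" if "u \<in> E\<^sub>0" "A u = 0" for u
    using that kernel[of u] by (simp add: E\<^sub>0_def A_def)
  have "\<exists>C. \<forall>u\<in>E\<^sub>0. G u \<le> C * N (A u)"
    using bd inj by (rule bounded_inverse[OF E0 E0c X0.complete_normed_functions_axioms lin img])
  then obtain C where C: "\<And>u. u \<in> E\<^sub>0 \<Longrightarrow> G u \<le> C * N (A u)" by blast
  show ?thesis
  proof (intro exI[of _ "\<bar>C\<bar>"] conjI ballI impI)
    fix u assume u: "u \<in> E" "coord u = 0"
    then have "G u \<le> C * N (A u)" using C by (simp add: E\<^sub>0_def)
    also have "\<dots> \<le> \<bar>C\<bar> * N (A u)" using u by (intro mult_right_mono) (auto simp: A_def X.norm_nonneg)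
    finally show "G u \<le> \<bar>C\<bar> * N (L u - cscale lam u)" by (simp add: A_def)
  qed simp
qed

definition correction :: "complex \<Rightarrow> complex^'k \<Rightarrow> ('a \<Rightarrow> complex) \<Rightarrow> bool" where
  "correction \<mu> v u \<longleftrightarrow> u \<in> E \<and>
     L u - cscale lam u = - (B (comb v) - cscale \<mu> (comb v)) \<and> coord u = 0"

text \<open>The right-hand side is solvable exactly when its coordinates vanish, and that is the
  eigenvector equation for \<open>reduced_matrix\<close>. Two solutions differ by an eigenfunction,
  which the condition on \<open>coord\<close> forces to be 0.\<close>

lemma ex1_correction:
  assumes "reduced_matrix *v v = \<mu> *s v"
  shows "\<exists>!u. correction \<mu> v u"
proof (rule ex_ex1I)
  define f where "f = cscale \<mu> (comb v) - B (comb v)"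
  have "f \<in> X" "coord f = 0" using assms by (auto simp: f_def coord_diff coord_scale coord_B_comb)
  then obtain u where u: "u \<in> E" "L u - cscale lam u = f" using solvable by blast
  have "correction \<mu> v (u - comb (coord u))"
    using u by (simp add: correction_def L_diff L_comb cfun.scale_right_diff_distrib f_def coord_diff)
  then show "\<exists>u. correction \<mu> v u" by blast
next
  fix u w assume "correction \<mu> v u" "correction \<mu> v w"
  then have "u \<in> E" "w \<in> E" "coord (u - w) = 0" "L u - cscale lam u = L w - cscale lam w"
    by (auto simp: correction_def coord_diff)
  moreover from this have "L (u - w) = cscale lam (u - w)"
    by (simp add: L_diff cfun.scale_right_diff_distrib algebra_simps)
  ultimately show "u = w" using kernel[of "u - w"] by simp
qed

end

text \<open>What is kept of C1 dependence: a Lipschitz bound at 0 in the norm \<open>G\<close> and a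
  derivative of the eigenvalue at 0. The filter \<open>at 0\<close> omits the point 0, hence the
  separate assumptions on \<open>Q 0\<close> and \<open>l 0\<close>.\<close>

locale eigenpair_family = degenerate_perturbation X E N G L B lam q coord C\<^sub>B C\<^sub>c
  for X E :: "('a \<Rightarrow> complex) set" and N G and L B :: "('a \<Rightarrow> complex) \<Rightarrow> ('a \<Rightarrow> complex)"
    and lam and q :: "'k::finite \<Rightarrow> 'a \<Rightarrow> complex" and coord and C\<^sub>B C\<^sub>c +
  fixes Q :: "real \<Rightarrow> 'a \<Rightarrow> complex" and l :: "real \<Rightarrow> complex" and \<mu> :: complex and C\<^sub>Q :: real
  assumes family: "\<forall>\<^sub>F \<epsilon> in at 0. Q \<epsilon> \<in> E \<and>
      L (Q \<epsilon>) + cscale (of_real \<epsilon>) (B (Q \<epsilon>)) = cscale (l \<epsilon>) (Q \<epsilon>) \<and> G (Q \<epsilon> - Q 0) \<le> C\<^sub>Q * \<bar>\<epsilon>\<bar>"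
    and start: "Q 0 \<in> E" "L (Q 0) = cscale lam (Q 0)" "Q 0 \<noteq> 0"
    and eigenvalue: "l 0 = lam" "(l has_vector_derivative \<mu>) (at 0)"
begin

lemma comb_start: "comb (coord (Q 0)) = Q 0"
  using comb_coord start by simp

lemma coord_start_nonzero: "coord (Q 0) \<noteq> 0"
  using kernel start by blast

lemma eigenvalue_Lipschitz: "\<forall>\<^sub>F \<epsilon> in at 0. cmod (l \<epsilon> - lam) \<le> (cmod \<mu> + 1) * \<bar>\<epsilon>\<bar>"
proof -
  have "((\<lambda>x. cmod ((l x - lam) / of_real x)) \<longlongrightarrow> cmod \<mu>) (at 0)"
    using has_vector_derivative_difference_quotient[OF eigenvalue(2)]
    unfolding eigenvalue(1) by (rule tendsto_norm)
  then have "\<forall>\<^sub>F x in at 0. cmod ((l x - lam) / of_real x) < cmod \<mu> + 1"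
    by (rule order_tendstoD) simp
  moreover have "\<forall>\<^sub>F x::real in at 0. x \<noteq> 0" by (simp add: eventually_at_filter)
  ultimately show ?thesis
    by eventually_elim (simp add: norm_divide divide_simps)
qed

text \<open>
  The remainder is of second order although \<open>Q\<close> is only Lipschitz at \<open>0\<close>: both
  \<open>B\<close> and \<open>l \<epsilon> - lam\<close> come with a factor \<open>\<epsilon>\<close>.
\<close>

lemma reduced_equation:
  obtains C where "\<forall>\<^sub>F \<epsilon> in at 0.
    norm ((l \<epsilon> - lam) *s coord (Q 0) - of_real \<epsilon> *s (reduced_matrix *v coord (Q 0))) \<le> C * \<epsilon>\<^sup>2"
proof -
  define v where "v = coord (Q 0)"
  have bound: "norm ((l \<epsilon> - lam) *s v - of_real \<epsilon> *s (reduced_matrix *v v))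
      \<le> (\<bar>C\<^sub>c\<bar> * (\<bar>C\<^sub>B\<bar> * \<bar>C\<^sub>Q\<bar>) + (cmod \<mu> + 1) * (\<bar>C\<^sub>c\<bar> * \<bar>C\<^sub>Q\<bar>)) * \<epsilon>\<^sup>2"
    if l: "cmod (l \<epsilon> - lam) \<le> (cmod \<mu> + 1) * \<bar>\<epsilon>\<bar>" and
      f: "Q \<epsilon> \<in> E \<and> L (Q \<epsilon>) + cscale (of_real \<epsilon>) (B (Q \<epsilon>)) = cscale (l \<epsilon>) (Q \<epsilon>) \<and> G (Q \<epsilon> - Q 0) \<le> C\<^sub>Q * \<bar>\<epsilon>\<bar>"
    for \<epsilon>
  proof -
    define D where "D = Q \<epsilon> - Q 0"
    have D: "D \<in> E" "Q \<epsilon> \<in> E" and GD: "G D \<le> \<bar>C\<^sub>Q\<bar> * \<bar>\<epsilon>\<bar>"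
      using f start order_trans[of "G D" "C\<^sub>Q * \<bar>\<epsilon>\<bar>" "\<bar>C\<^sub>Q\<bar> * \<bar>\<epsilon>\<bar>"]
      by (auto simp: D_def mult_right_mono)
    have cle: "norm (coord u) \<le> \<bar>C\<^sub>c\<bar> * K" if "u \<in> X" "N u \<le> K" for u K
    proof -
      have "norm (coord u) \<le> \<bar>C\<^sub>c\<bar> * N u"
        using coord_le[OF that(1)] X.norm_nonneg[OF that(1)] by (meson abs_ge_self mult_right_mono order_trans)
      also have "\<dots> \<le> \<bar>C\<^sub>c\<bar> * K" using that by (intro mult_left_mono) auto
      finally show ?thesis .
    qed
    have c1: "norm (coord D) \<le> \<bar>C\<^sub>c\<bar> * (\<bar>C\<^sub>Q\<bar> * \<bar>\<epsilon>\<bar>)" using cle N_le[of D] D GD by simp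
    have "N (B D) \<le> \<bar>C\<^sub>B\<bar> * G D"
      using B_le[OF D(1)] E.norm_nonneg[OF D(1)] by (meson abs_ge_self mult_right_mono order_trans)
    also have "\<dots> \<le> \<bar>C\<^sub>B\<bar> * (\<bar>C\<^sub>Q\<bar> * \<bar>\<epsilon>\<bar>)" using GD by (intro mult_left_mono) auto
    finally have c2: "norm (coord (B D)) \<le> \<bar>C\<^sub>c\<bar> * (\<bar>C\<^sub>B\<bar> * (\<bar>C\<^sub>Q\<bar> * \<bar>\<epsilon>\<bar>))" using cle D by simp
    \<comment> \<open>Applying \<open>coord\<close> replaces \<open>L\<close> by the scalar
      \<open>lam\<close>. After splitting \<open>Q \<epsilon>\<close> into \<open>Q 0 + D\<close>,
      the unknown \<open>D\<close> occurs only next to \<epsilon> or next to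
      \<open>l \<epsilon> - lam\<close>.\<close>
    have "coord (L (Q \<epsilon>) + cscale (of_real \<epsilon>) (B (Q \<epsilon>))) = coord (cscale (l \<epsilon>) (Q \<epsilon>))" using f by simp
    then have "lam *s coord (Q \<epsilon>) + of_real \<epsilon> *s coord (B (Q \<epsilon>)) = l \<epsilon> *s coord (Q \<epsilon>)"
      using D by (simp add: coord_add coord_scale coord_L)
    moreover have "coord (Q \<epsilon>) = v + coord D" using D start by (simp add: v_def D_def coord_diff)
    moreover have "coord (B (Q \<epsilon>)) = reduced_matrix *v v + coord (B D)"
      using D start unfolding v_def coord_B_comb[symmetric] comb_start D_def by (simp add: B_diff coord_diff)
    ultimately have "(l \<epsilon> - lam) *s v - of_real \<epsilon> *s (reduced_matrix *v v)
        = of_real \<epsilon> *s coord (B D) - (l \<epsilon> - lam) *s coord D"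
      by (simp add: vec_eq_iff algebra_simps)
    also have "norm \<dots> \<le> \<bar>\<epsilon>\<bar> * norm (coord (B D)) + cmod (l \<epsilon> - lam) * norm (coord D)"
      using norm_triangle_ineq4 by (metis norm_of_real norm_vector_scalar_mult)
    also have "\<dots> \<le> \<bar>\<epsilon>\<bar> * (\<bar>C\<^sub>c\<bar> * (\<bar>C\<^sub>B\<bar> * (\<bar>C\<^sub>Q\<bar> * \<bar>\<epsilon>\<bar>))) + ((cmod \<mu> + 1) * \<bar>\<epsilon>\<bar>) * (\<bar>C\<^sub>c\<bar> * (\<bar>C\<^sub>Q\<bar> * \<bar>\<epsilon>\<bar>))"
      using c1 c2 l by (intro add_mono mult_mono) auto
    also have "\<dots> = (\<bar>C\<^sub>c\<bar> * (\<bar>C\<^sub>B\<bar> * \<bar>C\<^sub>Q\<bar>) + (cmod \<mu> + 1) * (\<bar>C\<^sub>c\<bar> * \<bar>C\<^sub>Q\<bar>)) * \<bar>\<epsilon>\<bar>\<^sup>2"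
      by (simp add: power2_eq_square algebra_simps)
    finally show ?thesis by simp
  qed
  have "\<forall>\<^sub>F \<epsilon> in at 0. norm ((l \<epsilon> - lam) *s v - of_real \<epsilon> *s (reduced_matrix *v v))
      \<le> (\<bar>C\<^sub>c\<bar> * (\<bar>C\<^sub>B\<bar> * \<bar>C\<^sub>Q\<bar>) + (cmod \<mu> + 1) * (\<bar>C\<^sub>c\<bar> * \<bar>C\<^sub>Q\<bar>)) * \<epsilon>\<^sup>2"
    using eigenvalue_Lipschitz family by eventually_elim (rule bound)
  then show thesis using that by (simp add: v_def)
qed

text \<open>Divide \<open>reduced_equation\<close> by \<epsilon> and let \<epsilon> tend to 0, entry
  by entry: the quotient of \<open>l\<close> tends to \<open>\<mu>\<close> while the error tends to
  0.\<close>

lemma reduced_eigenvector: "reduced_matrix *v coord (Q 0) = \<mu> *s coord (Q 0)"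
proof -
  define v where "v = coord (Q 0)"
  define w where "w = reduced_matrix *v v"
  obtain C where C: "\<forall>\<^sub>F \<epsilon> in at 0. norm ((l \<epsilon> - lam) *s v - of_real \<epsilon> *s w) \<le> C * \<epsilon>\<^sup>2"
    using reduced_equation unfolding v_def w_def by blast
  have nz: "\<forall>\<^sub>F x::real in at 0. x \<noteq> 0" by (simp add: eventually_at_filter)
  have "w $ i = \<mu> * v $ i" for i
  proof -
    have "((\<lambda>\<epsilon>. (l \<epsilon> - lam) / of_real \<epsilon> * v $ i - w $ i) \<longlongrightarrow> \<mu> * v $ i - w $ i) (at 0)"
      using has_vector_derivative_difference_quotient[OF eigenvalue(2)]
      unfolding eigenvalue(1) by (intro tendsto_intros)
    moreover have "((\<lambda>\<epsilon>. (l \<epsilon> - lam) / of_real \<epsilon> * v $ i - w $ i) \<longlongrightarrow> 0) (at 0)"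
    proof (rule Lim_null_comparison)
      show "\<forall>\<^sub>F \<epsilon> in at 0. norm ((l \<epsilon> - lam) / of_real \<epsilon> * v $ i - w $ i) \<le> C * \<bar>\<epsilon>\<bar>"
        using C nz
      proof eventually_elim
        case (elim \<epsilon>)
        have "\<bar>\<epsilon>\<bar> * cmod ((l \<epsilon> - lam) / of_real \<epsilon> * v $ i - w $ i)
            = cmod (of_real \<epsilon> * ((l \<epsilon> - lam) / of_real \<epsilon> * v $ i - w $ i))"
          by (simp add: norm_mult)
        also have "\<dots> = cmod (((l \<epsilon> - lam) *s v - of_real \<epsilon> *s w) $ i)"
          using elim by (simp add: right_diff_distrib) (simp add: algebra_simps)
        also have "\<dots> \<le> norm ((l \<epsilon> - lam) *s v - of_real \<epsilon> *s w)" by (rule Finite_Cartesian_Product.norm_nth_le)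
        also have "\<dots> \<le> \<bar>\<epsilon>\<bar> * (C * \<bar>\<epsilon>\<bar>)" using elim by (simp add: power2_eq_square mult.left_commute)
        finally show ?case using elim by simp
      qed
      show "((\<lambda>\<epsilon>::real. C * \<bar>\<epsilon>\<bar>) \<longlongrightarrow> 0) (at 0)"
        by (intro tendsto_eq_intros) auto
    qed
    ultimately have "\<mu> * v $ i - w $ i = 0" by (intro tendsto_unique[of "at (0::real)"]) auto
    then show ?thesis by simp
  qed
  then show ?thesis by (simp add: vec_eq_iff v_def w_def)
qed

text \<open>Once the starting coordinates are known to be an eigenvector, the left-hand side of
  \<open>reduced_equation\<close> is the scalar eigenvalue remainder times a fixed nonzero vector,
  whose norm can be divided out.\<close>

lemma eigenvalue_second_order:
  obtains C where "C \<ge> 0" "\<forall>\<^sub>F \<epsilon> in at 0. cmod (l \<epsilon> - (lam + of_real \<epsilon> * \<mu>)) \<le> C * \<epsilon>\<^sup>2"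
proof -
  define v where "v = coord (Q 0)"
  have v: "norm v > 0" using coord_start_nonzero by (simp add: v_def)
  obtain C where C: "\<forall>\<^sub>F \<epsilon> in at 0. norm ((l \<epsilon> - lam) *s v - of_real \<epsilon> *s (\<mu> *s v)) \<le> C * \<epsilon>\<^sup>2"
    using reduced_equation unfolding v_def reduced_eigenvector by blast
  have "\<forall>\<^sub>F \<epsilon> in at 0. cmod (l \<epsilon> - (lam + of_real \<epsilon> * \<mu>)) \<le> \<bar>C\<bar> / norm v * \<epsilon>\<^sup>2"
    using C
  proof eventually_elim
    case (elim \<epsilon>)
    have eq: "(l \<epsilon> - lam) *s v - of_real \<epsilon> *s (\<mu> *s v) = (l \<epsilon> - (lam + of_real \<epsilon> * \<mu>)) *s v"
      by (simp add: vec_eq_iff algebra_simps)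
    have "cmod (l \<epsilon> - (lam + of_real \<epsilon> * \<mu>)) * norm v \<le> C * \<epsilon>\<^sup>2"
      using elim unfolding eq norm_vector_scalar_mult .
    also have "\<dots> \<le> \<bar>C\<bar> * \<epsilon>\<^sup>2" by (intro mult_right_mono) auto
    finally show ?case using v by (simp add: field_simps)
  qed
  then show thesis using that[of "\<bar>C\<bar> / norm v"] v by simp
qed

text \<open>The remainder \<open>Z\<close> has zero coordinates by construction, so the bounded
  inverse reduces its size in \<open>G\<close> to the size of \<open>L Z - lam Z\<close> in
  \<open>N\<close>.\<close>

lemma eigenfunction_second_order:
  assumes u: "correction \<mu> (coord (Q 0)) u"
  obtains C where "\<forall>\<^sub>F \<epsilon> in at 0.
    Q \<epsilon> \<in> E \<and> G (Q \<epsilon> - (comb (coord (Q \<epsilon>)) + cscale (of_real \<epsilon>) u)) \<le> C * \<epsilon>\<^sup>2"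
proof -
  obtain C\<^sub>l where C\<^sub>l: "C\<^sub>l \<ge> 0" "\<forall>\<^sub>F \<epsilon> in at 0. cmod (l \<epsilon> - (lam + of_real \<epsilon> * \<mu>)) \<le> C\<^sub>l * \<epsilon>\<^sup>2"
    by (rule eigenvalue_second_order) blast
  obtain C where C: "C \<ge> 0" "\<And>u. u \<in> E \<Longrightarrow> coord u = 0 \<Longrightarrow> G u \<le> C * N (L u - cscale lam u)"
    using shifted_inverse_bounded by blast
  have uE: "u \<in> E" and u0: "coord u = 0" and Lu: "L u = cscale lam u - (B (Q 0) - cscale \<mu> (Q 0))"
    using u by (auto simp: correction_def comb_start algebra_simps)
  \<comment> \<open>One summand for each term of \<open>L Z - lam Z\<close> computed below: the
    eigenvalue remainder times \<open>Q \<epsilon>\<close>, and \<epsilon> times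
    \<open>\<mu> D\<close> and \<open>B D\<close>. The restriction of \<epsilon> to [-1, 1] keeps
    \<open>N (Q \<epsilon>)\<close> bounded.\<close>
  define K where "K = C\<^sub>l * (N (Q 0) + \<bar>C\<^sub>Q\<bar>) + cmod \<mu> * \<bar>C\<^sub>Q\<bar> + \<bar>C\<^sub>B\<bar> * \<bar>C\<^sub>Q\<bar>"
  have small: "\<forall>\<^sub>F \<epsilon>::real in at 0. \<bar>\<epsilon>\<bar> \<le> 1"
    by (auto simp: eventually_at dist_real_def intro!: exI[of _ 1])
  have "\<forall>\<^sub>F \<epsilon> in at 0.
    Q \<epsilon> \<in> E \<and> G (Q \<epsilon> - (comb (coord (Q \<epsilon>)) + cscale (of_real \<epsilon>) u)) \<le> (C * K) * \<epsilon>\<^sup>2"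
    using C\<^sub>l(2) family small
  proof eventually_elim
    case (elim \<epsilon>)
    define D where "D = Q \<epsilon> - Q 0"
    have D: "D \<in> E" "Q \<epsilon> \<in> E" and GD: "G D \<le> \<bar>C\<^sub>Q\<bar> * \<bar>\<epsilon>\<bar>"
      using elim start order_trans[of "G D" "C\<^sub>Q * \<bar>\<epsilon>\<bar>" "\<bar>C\<^sub>Q\<bar> * \<bar>\<epsilon>\<bar>"]
      by (auto simp: D_def mult_right_mono)
    define r where "r = l \<epsilon> - (lam + of_real \<epsilon> * \<mu>)"
    define Z where "Z = Q \<epsilon> - (comb (coord (Q \<epsilon>)) + cscale (of_real \<epsilon>) u)"
    have Z: "Z \<in> E" "coord Z = 0"
      using D uE u0 by (auto simp: Z_def coord_diff coord_add coord_scale)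
    have LQ: "L (Q \<epsilon>) = cscale (l \<epsilon>) (Q \<epsilon>) - cscale (of_real \<epsilon>) (B (Q \<epsilon>))"
      using elim by (simp add: algebra_simps)
    have BD: "B D = B (Q \<epsilon>) - B (Q 0)" using D start by (simp add: D_def B_diff)
    \<comment> \<open>The combination of modes is annihilated by \<open>L - lam\<close>, and the
      equation for \<open>u\<close> turns \<epsilon> times \<open>B (Q \<epsilon>)\<close> and
      \<open>\<mu> Q \<epsilon>\<close> into \<epsilon> times \<open>B D\<close> and
      \<open>\<mu> D\<close>. Nothing of first order survives.\<close>
    have eq: "L Z - cscale lam Z = cscale r (Q \<epsilon>) + (cscale (of_real \<epsilon> * \<mu>) D - cscale (of_real \<epsilon>) (B D))"
      using D uE unfolding Z_def
      by (simp add: L_diff linear_onD[OF L_linear] L_comb LQ Lu BD)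
        (simp add: D_def r_def fun_eq_iff pointwise cscale_def algebra_simps)
    have "N (L Z - cscale lam Z) \<le> cmod r * N (Q \<epsilon>) + (\<bar>\<epsilon>\<bar> * cmod \<mu> * N D + \<bar>\<epsilon>\<bar> * N (B D))"
      using X.add_le[of "cscale r (Q \<epsilon>)" "cscale (of_real \<epsilon> * \<mu>) D - cscale (of_real \<epsilon>) (B D)"]
        X.diff_le[of "cscale (of_real \<epsilon> * \<mu>) D" "cscale (of_real \<epsilon>) (B D)"] D
      unfolding eq by (simp add: X.scale norm_mult)
    also have "\<dots> \<le> C\<^sub>l * \<epsilon>\<^sup>2 * (N (Q 0) + \<bar>C\<^sub>Q\<bar>) +
        (\<bar>\<epsilon>\<bar> * cmod \<mu> * (\<bar>C\<^sub>Q\<bar> * \<bar>\<epsilon>\<bar>) + \<bar>\<epsilon>\<bar> * (\<bar>C\<^sub>B\<bar> * (\<bar>C\<^sub>Q\<bar> * \<bar>\<epsilon>\<bar>)))"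
    proof -
      have ND: "N D \<le> \<bar>C\<^sub>Q\<bar> * \<bar>\<epsilon>\<bar>" using N_le[OF D(1)] GD by simp
      also have "\<dots> \<le> \<bar>C\<^sub>Q\<bar>" using elim by (simp add: mult_left_le)
      finally have NQ: "N (Q \<epsilon>) \<le> N (Q 0) + \<bar>C\<^sub>Q\<bar>"
        using X.le_add_diff[of "Q \<epsilon>" "Q 0"] D start by (simp add: D_def)
      have "N (B D) \<le> \<bar>C\<^sub>B\<bar> * G D"
        using B_le[OF D(1)] E.norm_nonneg[OF D(1)] by (meson abs_ge_self mult_right_mono order_trans)
      also have "\<dots> \<le> \<bar>C\<^sub>B\<bar> * (\<bar>C\<^sub>Q\<bar> * \<bar>\<epsilon>\<bar>)" using GD by (intro mult_left_mono) auto
      finally have NB: "N (B D) \<le> \<bar>C\<^sub>B\<bar> * (\<bar>C\<^sub>Q\<bar> * \<bar>\<epsilon>\<bar>)" .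
      show ?thesis using ND NQ NB elim C\<^sub>l(1) D X.norm_nonneg
        by (intro add_mono mult_mono) (auto simp: r_def)
    qed
    also have "\<dots> = K * \<bar>\<epsilon>\<bar>\<^sup>2"
      unfolding K_def power2_abs[symmetric, of \<epsilon>] by (simp add: power2_eq_square algebra_simps)
    finally have "N (L Z - cscale lam Z) \<le> K * \<epsilon>\<^sup>2" by simp
    then have "G Z \<le> C * (K * \<epsilon>\<^sup>2)"
      using C(2)[OF Z] C(1) by (meson mult_left_mono order_trans)
    then show ?case using D by (simp add: Z_def mult.assoc)
  qed
  then show thesis by (rule that)
qed

lemma eigenvalue_expansion: "(\<lambda>\<epsilon>. norm (l \<epsilon> - (lam + of_real \<epsilon> * \<mu>))) \<in> O[at 0](\<lambda>\<epsilon>. \<epsilon>\<^sup>2)"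
proof -
  obtain C where C: "\<forall>\<^sub>F \<epsilon> in at 0. cmod (l \<epsilon> - (lam + of_real \<epsilon> * \<mu>)) \<le> C * \<epsilon>\<^sup>2"
    by (rule eigenvalue_second_order) blast
  show ?thesis
  proof (rule bigoI)
    show "\<forall>\<^sub>F \<epsilon> in at 0. norm (norm (l \<epsilon> - (lam + of_real \<epsilon> * \<mu>))) \<le> C * norm (\<epsilon>\<^sup>2)"
      using C by simp
  qed
qed

lemma eigenfunction_expansion:
  assumes "correction \<mu> (coord (Q 0)) u"
  shows "(\<lambda>\<epsilon>. G (Q \<epsilon> - (comb (coord (Q \<epsilon>)) + cscale (of_real \<epsilon>) u))) \<in> O[at 0](\<lambda>\<epsilon>. \<epsilon>\<^sup>2)"
proof -
  have uE: "u \<in> E" using assms by (simp add: correction_def)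
  obtain C where C: "\<forall>\<^sub>F \<epsilon> in at 0.
    Q \<epsilon> \<in> E \<and> G (Q \<epsilon> - (comb (coord (Q \<epsilon>)) + cscale (of_real \<epsilon>) u)) \<le> C * \<epsilon>\<^sup>2"
    by (rule eigenfunction_second_order[OF assms]) blast
  show ?thesis
  proof (rule bigoI)
    show "\<forall>\<^sub>F \<epsilon> in at 0. norm (G (Q \<epsilon> - (comb (coord (Q \<epsilon>)) + cscale (of_real \<epsilon>) u))) \<le> C * norm (\<epsilon>\<^sup>2)"
      using C by eventually_elim (simp add: uE E.norm_nonneg)
  qed
qed

text \<open>Replacing the current coordinates by the initial ones changes the reference function by
  \<open>comb\<close> of their difference, which \<open>comb_le\<close> bounds by a constant times
  an O(\<epsilon>^2) quantity.\<close>

lemma normalized_eigenfunction_expansion: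
  assumes u: "correction \<mu> (coord (Q 0)) u"
    and v: "(\<lambda>\<epsilon>. norm (coord (Q \<epsilon>) - coord (Q 0))) \<in> O[at 0](\<lambda>\<epsilon>. \<epsilon>\<^sup>2)"
  shows "(\<lambda>\<epsilon>. G (Q \<epsilon> - (comb (coord (Q 0)) + cscale (of_real \<epsilon>) u))) \<in> O[at 0](\<lambda>\<epsilon>. \<epsilon>\<^sup>2)"
proof -
  have uE: "u \<in> E" using u by (simp add: correction_def)
  define S where "S = (\<Sum>k\<in>UNIV. G (q k))"
  have "(\<lambda>\<epsilon>. G (Q \<epsilon> - (comb (coord (Q \<epsilon>)) + cscale (of_real \<epsilon>) u)) +
      S * norm (coord (Q \<epsilon>) - coord (Q 0))) \<in> O[at 0](\<lambda>\<epsilon>. \<epsilon>\<^sup>2)"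
    using eigenfunction_expansion[OF u] v by (intro sum_in_bigo) auto
  moreover have "(\<lambda>\<epsilon>. G (Q \<epsilon> - (comb (coord (Q 0)) + cscale (of_real \<epsilon>) u))) \<in>
    O[at 0](\<lambda>\<epsilon>. G (Q \<epsilon> - (comb (coord (Q \<epsilon>)) + cscale (of_real \<epsilon>) u)) +
      S * norm (coord (Q \<epsilon>) - coord (Q 0)))"
  proof (rule bigoI[where c = 1])
    show "\<forall>\<^sub>F \<epsilon> in at 0. norm (G (Q \<epsilon> - (comb (coord (Q 0)) + cscale (of_real \<epsilon>) u))) \<le>
      1 * norm (G (Q \<epsilon> - (comb (coord (Q \<epsilon>)) + cscale (of_real \<epsilon>) u)) +
      S * norm (coord (Q \<epsilon>) - coord (Q 0)))"
      using family
    proof eventually_elim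
      case (elim \<epsilon>)
      let ?a = "coord (Q \<epsilon>)" and ?v = "coord (Q 0)"
      have mem: "Q \<epsilon> - (comb w + cscale (of_real \<epsilon>) u) \<in> E" for w using elim uE by simp
      have eq: "Q \<epsilon> - (comb ?v + cscale (of_real \<epsilon>) u) = (Q \<epsilon> - (comb ?a + cscale (of_real \<epsilon>) u)) + comb (?a - ?v)"
        by (simp add: comb_diff)
      have "G (Q \<epsilon> - (comb ?v + cscale (of_real \<epsilon>) u)) \<le>
        G (Q \<epsilon> - (comb ?a + cscale (of_real \<epsilon>) u)) + S * norm (?a - ?v)"
        using E.add_le[OF mem comb_mem, of ?a "?a - ?v"] comb_le[of "?a - ?v"] unfolding eq S_def by linarith
      moreover have "norm a \<le> 1 * norm b" if "0 \<le> a" "a \<le> b" for a b :: real using that by simp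
      ultimately show ?case using E.norm_nonneg[OF mem[of ?v]] by blast
    qed
  qed
  ultimately show ?thesis using landau_o.big_trans by blast
qed

end

section \<open>Linearity of the backward operators\<close>

lemma cscale_apply: "cscale c u z = c * u z"
  by (simp add: cscale_def)

lemma frechet_derivative_eqI: "(f has_derivative f') (at x) \<Longrightarrow> frechet_derivative f (at x) = f'"
  using frechet_derivative_at by metis

lemma C1_fun_has_derivative: "C1_fun u \<Longrightarrow> (u has_derivative frechet_derivative u (at z)) (at z)"
  by (simp add: C1_fun_def frechet_derivative_works)

lemma C1_fun_add:
  assumes "C1_fun u" "C1_fun w"
  shows "C1_fun (u + w)"
    and frechet_derivative_add: "frechet_derivative (u + w) (at z) v = frechet_derivative u (at z) v + frechet_derivative w (at z) v"
proof -
  have d: "((u + w) has_derivative (\<lambda>h. frechet_derivative u (at z) h + frechet_derivative w (at z) h)) (at z)" for z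
    unfolding plus_fun_def by (intro has_derivative_add C1_fun_has_derivative assms)
  show *: "frechet_derivative (u + w) (at z) v = frechet_derivative u (at z) v + frechet_derivative w (at z) v" for z v
    using frechet_derivative_eqI[OF d] by simp
  show "C1_fun (u + w)"
    using assms d by (auto simp: C1_fun_def * differentiable_def intro!: continuous_on_add)
qed

lemma C1_fun_cscale:
  assumes "C1_fun u"
  shows "C1_fun (cscale c u)"
    and frechet_derivative_cscale: "frechet_derivative (cscale c u) (at z) v = c * frechet_derivative u (at z) v"
proof -
  have d: "(cscale c u has_derivative (\<lambda>h. c * frechet_derivative u (at z) h)) (at z)" for z
    unfolding cscale_def by (intro has_derivative_mult_right C1_fun_has_derivative assms)
  show *: "frechet_derivative (cscale c u) (at z) v = c * frechet_derivative u (at z) v" for z v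
    using frechet_derivative_eqI[OF d] by simp
  show "C1_fun (cscale c u)"
    using assms d by (auto simp: C1_fun_def * differentiable_def intro!: continuous_on_mult_left)
qed

lemma C1_fun_affine:
  assumes "C1_fun u" "bounded_linear T"
  shows "C1_fun (\<lambda>x. u (T x + c))"
    and frechet_derivative_affine: "frechet_derivative (\<lambda>x. u (T x + c)) (at z) v = frechet_derivative u (at (T z + c)) (T v)"
proof -
  have T: "((\<lambda>x. T x + c) has_derivative T) (at z)" for z
    using assms(2) by (auto intro!: derivative_eq_intros bounded_linear_imp_has_derivative)
  have d: "((\<lambda>x. u (T x + c)) has_derivative (\<lambda>h. frechet_derivative u (at (T z + c)) (T h))) (at z)" for z
    using has_derivative_compose[OF T C1_fun_has_derivative[OF assms(1)]] .
  show *: "frechet_derivative (\<lambda>x. u (T x + c)) (at z) v = frechet_derivative u (at (T z + c)) (T v)" for z v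
    using frechet_derivative_eqI[OF d] by simp
  have "continuous_on UNIV (\<lambda>x. frechet_derivative u (at (T x + c)) w)" for w
  proof -
    have "continuous_on UNIV (\<lambda>z. frechet_derivative u (at z) w)"
      using assms(1) by (simp add: C1_fun_def)
    moreover have "continuous_on UNIV (\<lambda>x. T x + c)"
      using assms(2) by (intro continuous_intros linear_continuous_on)
    ultimately show ?thesis by (rule continuous_on_compose2) auto
  qed
  then show "C1_fun (\<lambda>x. u (T x + c))"
    using d by (auto simp: C1_fun_def * differentiable_def)
qed

lemma C2_fun_add:
  assumes "C2_fun u" "C2_fun w"
  shows "C2_fun (u + w)"
proof -
  have "(\<lambda>z. frechet_derivative (u + w) (at z) v) =
      (\<lambda>z. frechet_derivative u (at z) v) + (\<lambda>z. frechet_derivative w (at z) v)" for v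
    using assms by (simp add: fun_eq_iff pointwise C2_fun_def frechet_derivative_add)
  then have "C1_fun (\<lambda>z. frechet_derivative (u + w) (at z) v)" for v
    using assms by (simp add: C2_fun_def C1_fun_add(1))
  then show ?thesis using assms by (auto simp: C2_fun_def C1_fun_add(1))
qed

lemma C2_fun_cscale:
  assumes "C2_fun u"
  shows "C2_fun (cscale c u)"
proof -
  have "(\<lambda>z. frechet_derivative (cscale c u) (at z) v) = cscale c (\<lambda>z. frechet_derivative u (at z) v)" for v
    using assms by (simp add: fun_eq_iff cscale_apply C2_fun_def frechet_derivative_cscale)
  then have "C1_fun (\<lambda>z. frechet_derivative (cscale c u) (at z) v)" for v
    using assms by (simp add: C2_fun_def C1_fun_cscale(1))
  then show ?thesis using assms by (auto simp: C2_fun_def C1_fun_cscale(1))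
qed

text \<open>Freezing one variable of a joint function is composition with an affine embedding; this
  is how the operators in one variable inherit C2 arguments.\<close>

lemma C2_fun_affine:
  assumes "C2_fun u" "bounded_linear T"
  shows "C2_fun (\<lambda>x. u (T x + c))"
  using assms by (auto simp: C2_fun_def C1_fun_affine(1) frechet_derivative_affine
      intro: C1_fun_affine(1)[where u = "\<lambda>z. frechet_derivative u (at z) _"])

lemma C2_fun_slice_fst: "C2_fun u \<Longrightarrow> C2_fun (\<lambda>x. u (x, y))"
  using C2_fun_affine[of u "\<lambda>x. (x, 0)" "(0, y)"]
  by (simp add: bounded_linear_Pair bounded_linear_ident bounded_linear_zero)

lemma C2_fun_slice_snd: "C2_fun u \<Longrightarrow> C2_fun (\<lambda>y. u (x, y))"
  using C2_fun_affine[of u "\<lambda>y. (0, y)" "(x, 0)"]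
  by (simp add: bounded_linear_Pair bounded_linear_ident bounded_linear_zero)

lemma C2_fun_zero: "C2_fun 0"
  by (simp add: zero_fun_def C2_fun_def C1_fun_def)

lemma C2_fun_C1_fun: "C2_fun u \<Longrightarrow> C1_fun u"
  by (simp add: C2_fun_def)

lemma C2_fun_C1_fun_pd: "C2_fun u \<Longrightarrow> C1_fun (pd i u)"
  by (simp add: C2_fun_def pd_def[abs_def])

lemma pd_add: "C1_fun u \<Longrightarrow> C1_fun w \<Longrightarrow> pd i (u + w) = pd i u + pd i w"
  by (simp add: fun_eq_iff pd_def pointwise frechet_derivative_add)

lemma pd_cscale: "C1_fun u \<Longrightarrow> pd i (cscale c u) = cscale c (pd i u)"
  by (simp add: fun_eq_iff pd_def cscale_apply frechet_derivative_cscale)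

lemma linear_on_add: "linear_on E A \<Longrightarrow> linear_on E A' \<Longrightarrow> linear_on E (\<lambda>u. A u + A' u)"
  by (simp add: linear_on_def cfun.scale_right_distrib algebra_simps)

lemma linear_on_cscale: "linear_on E A \<Longrightarrow> linear_on E (\<lambda>u. cscale c (A u))"
  by (simp add: linear_on_def cfun.scale_right_distrib mult.commute)

lemma linear_on_subset: "linear_on E A \<Longrightarrow> D \<subseteq> E \<Longrightarrow> linear_on D A"
  unfolding linear_on_def by (meson subsetD)

text \<open>Linearity is claimed only on C2 functions because \<open>frechet_derivative\<close> is
  an unspecified choice where no derivative exists.\<close>

lemma linear_bwd_transport: "linear_on {u. C2_fun u} (bwd_transport a)"
  unfolding linear_on_def bwd_transport_def
  by (auto simp: fun_eq_iff pd_add pd_cscale C2_fun_C1_fun pointwise cscale_apply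
      sum.distrib distrib_left sum_distrib_left mult.left_commute)

lemma linear_bwd_diffusion: "linear_on {u. C2_fun u} (bwd_diffusion g)"
  unfolding linear_on_def bwd_diffusion_def
  by (auto simp: fun_eq_iff pd_add pd_cscale C2_fun_C1_fun C2_fun_C1_fun_pd pointwise
      cscale_apply
      sum.distrib distrib_left sum_distrib_left mult.left_commute)

lemma linear_bwd_osc: "linear_on {u. C2_fun u} (bwd_osc f g)"
  unfolding bwd_osc_def[abs_def] by (intro linear_on_add linear_bwd_transport linear_bwd_diffusion)

lemma linear_in_x:
  assumes "\<And>y. linear_on {u. C2_fun u} (A y)"
  shows "linear_on {u. C2_fun u} (in_x A)"
proof -
  have "A y (\<lambda>x'. (u + w) (x', y)) = A y (\<lambda>x'. u (x', y)) + A y (\<lambda>x'. w (x', y))"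
    if "C2_fun u" "C2_fun w" for u w y
    using linear_onD(1)[OF assms, of "\<lambda>x'. u (x', y)" "\<lambda>x'. w (x', y)"] that
    by (simp add: C2_fun_slice_fst plus_fun_def)
  moreover have "A y (\<lambda>x'. cscale c u (x', y)) = cscale c (A y (\<lambda>x'. u (x', y)))"
    if "C2_fun u" for u c y
    using linear_onD(2)[OF assms, of "\<lambda>x'. u (x', y)"] that
    by (simp add: C2_fun_slice_fst cscale_def)
  ultimately show ?thesis
    by (simp add: linear_on_def in_x_def fun_eq_iff pointwise cscale_apply)
qed

lemma linear_in_y:
  assumes "\<And>x. linear_on {u. C2_fun u} (A x)"
  shows "linear_on {u. C2_fun u} (in_y A)"
proof -
  have "A x (\<lambda>y'. (u + w) (x, y')) = A x (\<lambda>y'. u (x, y')) + A x (\<lambda>y'. w (x, y'))"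
    if "C2_fun u" "C2_fun w" for u w x
    using linear_onD(1)[OF assms, of "\<lambda>y'. u (x, y')" "\<lambda>y'. w (x, y')"] that
    by (simp add: C2_fun_slice_snd plus_fun_def)
  moreover have "A x (\<lambda>y'. cscale c u (x, y')) = cscale c (A x (\<lambda>y'. u (x, y')))"
    if "C2_fun u" for u c x
    using linear_onD(2)[OF assms, of "\<lambda>y'. u (x, y')"] that
    by (simp add: C2_fun_slice_snd cscale_def)
  ultimately show ?thesis
    by (simp add: linear_on_def in_y_def fun_eq_iff pointwise cscale_apply)
qed

lemma linear_bwd_unperturbed: "linear_on {u. C2_fun u} (\<lambda>u. bwd_x S u + bwd_y S u)"
  unfolding bwd_x_def bwd_y_def by (intro linear_on_add linear_in_x linear_in_y linear_bwd_osc)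

lemma linear_bwd_tau: "linear_on {u. C2_fun u} (bwd_tau S)"
  unfolding bwd_tau_def[abs_def] by (intro linear_on_add linear_in_x linear_in_y linear_bwd_transport)

lemma linear_bwd_kappa: "linear_on {u. C2_fun u} (bwd_kappa S)"
  unfolding bwd_kappa_def[abs_def] by (intro linear_on_add linear_in_x linear_in_y linear_bwd_transport)

lemma linear_bwd_perturbation: "linear_on {u. C2_fun u} (bwd_perturbation S \<kappa> \<tau>)"
  unfolding bwd_perturbation_def[abs_def]
  by (intro linear_on_add linear_on_cscale linear_bwd_tau linear_bwd_kappa)

lemma subspace_C2_domain:
  assumes "cfun.subspace V" "\<And>A. A \<in> As \<Longrightarrow> linear_on {u. C2_fun u} A"
  shows "cfun.subspace (C2_domain V As)"
proof -
  have "A 0 = 0" if "A \<in> As" for A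
    using linear_onD(2)[OF assms(2)[OF that], of 0 0] by (simp add: C2_fun_zero)
  then show ?thesis
    using assms(1) linear_onD[OF assms(2)]
    by (auto simp: cfun.subspace_def C2_domain_def C2_fun_zero C2_fun_add C2_fun_cscale)
qed

lemma subspace_bdom: "cfun.subspace Obs \<Longrightarrow> cfun.subspace (bdom S Obs)"
  unfolding bdom_def
  by (rule subspace_C2_domain) (auto intro: linear_bwd_unperturbed linear_bwd_tau linear_bwd_kappa)

lemma bdom_subset: "bdom S Obs \<subseteq> {u. C2_fun u}" "bdom S Obs \<subseteq> Obs"
  by (auto simp: bdom_def C2_domain_def)

lemma bdomD:
  assumes "u \<in> bdom S Obs"
  shows "u \<in> Obs" "bwd_x S u + bwd_y S u \<in> Obs" "bwd_tau S u \<in> Obs" "bwd_kappa S u \<in> Obs"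
  using assms by (auto simp: bdom_def C2_domain_def)

text \<open>The perturbation is homogeneous in \<open>(\<kappa>, \<tau>)\<close>, so along a ray the
  joint operator is affine in \<epsilon>, the form \<open>L + \<epsilon> B\<close> of the abstract
  setting.\<close>

lemma bwd_eq: "bwd S (\<epsilon> * \<kappa>) (\<epsilon> * \<tau>) u = bwd_x S u + bwd_y S u + cscale (of_real \<epsilon>) (bwd_perturbation S \<kappa> \<tau> u)"
  by (simp add: bwd_def bwd_perturbation_def cfun.scale_right_distrib)

lemma bwd_unperturbed: "bwd S 0 0 u = bwd_x S u + bwd_y S u"
  using bwd_eq[of S 0 0 0 u] by simp

section \<open>The pairing\<close>

lemma pairing_cscale [simp]: "pairing (cscale c u) p = c * pairing u p"
  by (simp add: pairing_def cscale_def mult.assoc)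

lemma pairing_cscale_right [simp]: "pairing u (cscale c p) = c * pairing u p"
  by (simp add: pairing_def cscale_def mult.left_commute)

lemma pairing_add:
  assumes "dual_spaces Obs Den" "u \<in> Obs" "w \<in> Obs" "p \<in> Den"
  shows "pairing (u + w) p = pairing u p + pairing w p"
  using assms by (simp add: pairing_def dual_spaces_def distrib_right pointwise Bochner_Integration.integral_add)

lemma pairing_add_right:
  assumes "dual_spaces Obs Den" "u \<in> Obs" "p \<in> Den" "r \<in> Den"
  shows "pairing u (p + r) = pairing u p + pairing u r"
  using assms by (simp add: pairing_def dual_spaces_def distrib_left pointwise Bochner_Integration.integral_add)

text \<open>Fubini. Joint integrability is derived from that of the two factors, since the inner
  integral of the norm is a constant multiple of an integrable function.\<close>

lemma pairing_tensor:
  fixes a b :: "'a::euclidean_space \<Rightarrow> complex" and c d :: "'b::euclidean_space \<Rightarrow> complex"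
  assumes "integrable lborel (\<lambda>x. a x * b x)" "integrable lborel (\<lambda>y. c y * d y)"
  shows "pairing (\<lambda>(x, y). a x * c y) (\<lambda>(x, y). b x * d y) = pairing a b * pairing c d"
proof -
  define f where "f = (\<lambda>x. a x * b x)"
  define g where "g = (\<lambda>y. c y * d y)"
  have [measurable]: "f \<in> borel_measurable lborel" "g \<in> borel_measurable lborel"
    using assms by (auto simp: f_def g_def dest: borel_measurable_integrable)
  have "integrable (lborel \<Otimes>\<^sub>M lborel) (\<lambda>z. f (fst z) * g (snd z))"
  proof (rule lborel_pair.Fubini_integrable)
    show "integrable lborel (\<lambda>x. \<integral>y. norm (f (fst (x, y)) * g (snd (x, y))) \<partial>lborel)"
      using integrable_norm[OF assms(1)] by (simp add: norm_mult f_def)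
    show "AE x in lborel. integrable lborel (\<lambda>y. f (fst (x, y)) * g (snd (x, y)))"
      using assms by (simp add: g_def)
  qed measurable
  from lborel_pair.integral_fst'[OF this]
  have "integral\<^sup>L (lborel \<Otimes>\<^sub>M lborel) (\<lambda>z. f (fst z) * g (snd z)) = integral\<^sup>L lborel f * integral\<^sup>L lborel g"
    by simp
  then show ?thesis
    by (simp add: pairing_def f_def g_def lborel_prod split_beta algebra_simps)
qed

section \<open>Two-dimensional eigenspaces\<close>

lemma span_pair: "cfun.span {a, b} = {cscale x a + cscale y b | x y. True}"
proof -
  have "w - cscale x a = cscale y b \<longleftrightarrow> w = cscale x a + cscale y b" for w x y
    by (auto simp: algebra_simps)
  then show ?thesis by (simp add: cfun.span_insert cfun.span_singleton image_iff)
qed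

lemma complex_vec2_eq_iff: "v = w \<longleftrightarrow> v $ 1 = w $ 1 \<and> v $ 2 = w $ 2" for v w :: "complex^2"
  by (simp add: vec_eq_iff forall_2)

text \<open>Independence becomes a nonvanishing determinant, which algebraic simplification can
  handle. The clause \<open>a \<noteq> b\<close> is essential on the left: for equal vectors the set
  is a singleton, which may be independent.\<close>

lemma independent_pair_iff:
  fixes a b :: "complex^2"
  shows "a \<noteq> b \<and> vec.independent {a, b} \<longleftrightarrow> a $ 1 * b $ 2 \<noteq> a $ 2 * b $ 1"
proof (cases "b = 0")
  case True
  then show ?thesis using vec.dependent_zero[of "{a, b}"] by auto
next
  case False
  then have "a \<noteq> b \<and> vec.independent {a, b} \<longleftrightarrow> (\<nexists>k. a = k *s b)"
    by (cases "a = b") (auto simp: vec.independent_insert vec.span_singleton intro: exI[of _ 1])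
  also have "\<dots> \<longleftrightarrow> a $ 1 * b $ 2 \<noteq> a $ 2 * b $ 1"
  proof (intro arg_cong[where f = Not] iffI)
    assume eq: "a $ 1 * b $ 2 = a $ 2 * b $ 1"
    show "\<exists>k. a = k *s b"
    proof (cases "b $ 1 = 0")
      case True
      then have "b $ 2 \<noteq> 0" using False by (simp add: complex_vec2_eq_iff)
      then show ?thesis using True eq
        by (intro exI[of _ "a $ 2 / b $ 2"]) (simp add: complex_vec2_eq_iff)
    next
      case False
      then show ?thesis using eq
        by (intro exI[of _ "a $ 1 / b $ 1"]) (simp add: complex_vec2_eq_iff field_simps)
    qed
  qed auto
  finally show ?thesis .
qed

lemma diagonalized_by_iff:
  "diagonalized_by M l v \<longleftrightarrow>
    (\<forall>s. M *v v s = l s *s v s) \<and> v Upper $ 1 * v Lower $ 2 \<noteq> v Upper $ 2 * v Lower $ 1"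
  unfolding diagonalized_by_def independent_pair_iff ..

text \<open>Cramer's rule.\<close>

lemma pair_coordinates:
  fixes a b w :: "complex^2"
  assumes "a $ 1 * b $ 2 \<noteq> a $ 2 * b $ 1"
  obtains x y where "w = x *s a + y *s b"
proof -
  define d where "d = a $ 1 * b $ 2 - a $ 2 * b $ 1"
  have d: "d \<noteq> 0" using assms by (simp add: d_def)
  have "w = ((w $ 1 * b $ 2 - w $ 2 * b $ 1) / d) *s a + ((a $ 1 * w $ 2 - a $ 2 * w $ 1) / d) *s b"
    using d by (simp add: complex_vec2_eq_iff divide_simps) (simp add: d_def algebra_simps)
  then show thesis by (rule that)
qed

lemma sign_all: "(\<forall>s. P s) \<longleftrightarrow> P Upper \<and> P Lower"
  by (metis sign.exhaust)

text \<open>Expand each \<open>w s\<close> in the basis \<open>v\<close>: a coefficient can be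
  nonzero only if the two eigenvalues agree. If the eigenvalues of \<open>v\<close> coincide, this
  fixes the eigenvalues of \<open>w\<close> and any basis is allowed; if not, each
  \<open>w s\<close> is parallel to exactly one \<open>v\<close>.\<close>

lemma diagonalized_same_eigenpairs:
  assumes v: "diagonalized_by M l v" and w: "diagonalized_by M m w"
  shows "same_eigenpairs l v m w"
proof -
  have det: "v Upper $ 1 * v Lower $ 2 \<noteq> v Upper $ 2 * v Lower $ 1"
    and eig: "\<And>s. M *v v s = l s *s v s"
    using v by (auto simp: diagonalized_by_iff)
  have det': "w Upper $ 1 * w Lower $ 2 \<noteq> w Upper $ 2 * w Lower $ 1"
    and eig': "\<And>s. M *v w s = m s *s w s"
    using w by (auto simp: diagonalized_by_iff)
  have "\<exists>x y. w s = x *s v Upper + y *s v Lower" for s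
    using pair_coordinates[OF det, of "w s"] by blast
  then obtain x y where xy: "\<And>s. w s = x s *s v Upper + y s *s v Lower" by metis
  have zero: "x s * (m s - l Upper) = 0 \<and> y s * (m s - l Lower) = 0" for s
  proof -
    have "M *v w s = (x s * l Upper) *s v Upper + (y s * l Lower) *s v Lower"
      by (simp add: xy matrix_vector_right_distrib vec.scale eig vector_scalar_commute matrix_vector_mult_scaleR)
    then have "(x s * (m s - l Upper)) *s v Upper + (y s * (m s - l Lower)) *s v Lower = 0"
      unfolding eig' by (simp add: xy complex_vec2_eq_iff algebra_simps)
    then show ?thesis using det by (simp add: complex_vec2_eq_iff) algebra
  qed
  have nz: "x s \<noteq> 0 \<or> y s \<noteq> 0" for s
    using det' xy[of s] by (cases s) (auto simp: xy)
  show ?thesis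
  proof (cases "l Upper = l Lower")
    case True
    then have "m s = l s" for s using zero[of s] nz[of s] by (cases s) auto
    then show ?thesis using True unfolding same_eigenpairs_def by (intro exI[of _ id]) auto
  next
    case False
    \<comment> \<open>\<open>\<pi> s\<close> names the basis vector parallel to \<open>w s\<close>.
      Equal values for both signs would make the two \<open>w\<close> parallel, against their
      determinant.\<close>
    define \<pi> where "\<pi> s = (if x s = 0 then Lower else Upper)" for s
    have one: "x s = 0 \<or> y s = 0" for s using zero[of s] False by auto
    have "\<pi> Upper \<noteq> \<pi> Lower"
      using det' one[of Upper] one[of Lower] by (auto simp: \<pi>_def xy split: if_splits)
    then have "inj \<pi>" by (auto simp: inj_def sign_all)
    moreover have "surj \<pi>"
      using \<open>\<pi> Upper \<noteq> \<pi> Lower\<close> unfolding surj_def by (metis sign.exhaust)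
    ultimately have "bij \<pi>" by (simp add: bij_def)
    moreover have "m s = l (\<pi> s) \<and> (\<exists>a. a \<noteq> 0 \<and> w s = a *s v (\<pi> s))" for s
      using zero[of s] nz[of s] one[of s] xy[of s] by (auto simp: \<pi>_def)
    ultimately show ?thesis unfolding same_eigenpairs_def by blast
  qed
qed

text \<open>A maximal independent subset of \<open>S\<close> has the dimension of the span, here 2.
  It is used to pick two members of a possibly redundant family of eigenfunctions.\<close>

lemma basis_of_two_dimensional_span:
  assumes span: "cfun.span S = cfun.span {a, b}" and ind: "cfun.independent {a, b}" "a \<noteq> b"
  obtains c d where "c \<in> S" "d \<in> S" "cfun.span {c, d} = cfun.span {a, b}"
proof -
  obtain B where B: "B \<subseteq> S" "cfun.independent B" "S \<subseteq> cfun.span B"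
    using cfun.maximal_independent_subset[of S] by blast
  have "cfun.span B = cfun.span S"
    using B by (meson cfun.span_eq cfun.span_mono order_trans cfun.span_superset)
  then have spanB: "cfun.span B = cfun.span {a, b}" using span by simp
  have "card B = card {a, b}"
    using cfun.dim_eq_card_independent[OF B(2)] cfun.dim_eq_card_independent[OF ind(1)]
      cfun.dim_span[of B] cfun.dim_span[of "{a, b}"] spanB by metis
  then have "card B = 2" using ind(2) by simp
  then obtain c d where "B = {c, d}" by (auto simp: card_2_iff)
  then show thesis using that B spanB by auto
qed

section \<open>Coupled oscillators\<close>

text \<open>Only the derivative at 0 enters: its remainder quotient is eventually below 1, so 1 plus
  the norm of the derivative is a Lipschitz constant.\<close>

lemma C1_family_Lipschitz:
  assumes fam: "C1_family V G q" and V: "seminormed_functions V G"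
  shows "\<exists>C. \<forall>\<^sub>F \<epsilon> in at 0. q \<epsilon> \<in> V \<and> G (q \<epsilon> - q 0) \<le> C * \<bar>\<epsilon>\<bar>"
proof -
  interpret seminormed_functions V G by fact
  obtain q' where q': "\<And>\<epsilon>. \<epsilon> \<in> {-1..1} \<Longrightarrow> q \<epsilon> \<in> V \<and> q' \<epsilon> \<in> V \<and>
     ((\<lambda>\<eta>. G (q \<eta> - q \<epsilon> - cscale (of_real (\<eta> - \<epsilon>)) (q' \<epsilon>)) / \<bar>\<eta> - \<epsilon>\<bar>) \<longlongrightarrow> 0) (at \<epsilon> within {-1..1})"
    using fam unfolding C1_family_def by blast
  have at: "at (0::real) within {-1..1} = at 0" by (rule at_within_interior) simp
  have "((\<lambda>\<eta>. G (q \<eta> - q 0 - cscale (of_real \<eta>) (q' 0)) / \<bar>\<eta>\<bar>) \<longlongrightarrow> 0) (at 0)"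
    using q'[of 0] by (simp add: at)
  then have "\<forall>\<^sub>F \<eta> in at 0. G (q \<eta> - q 0 - cscale (of_real \<eta>) (q' 0)) / \<bar>\<eta>\<bar> < 1"
    by (rule order_tendstoD) simp
  moreover have "\<forall>\<^sub>F \<eta>::real in at 0. \<eta> \<noteq> 0 \<and> \<eta> \<in> {-1..1}"
    by (auto simp: eventually_at dist_real_def intro!: exI[of _ 1])
  ultimately have "\<forall>\<^sub>F \<eta> in at 0. q \<eta> \<in> V \<and> G (q \<eta> - q 0) \<le> (1 + G (q' 0)) * \<bar>\<eta>\<bar>"
  proof eventually_elim
    case (elim \<eta>)
    let ?w = "q \<eta> - q 0 - cscale (of_real \<eta>) (q' 0)"
    have mem: "q \<eta> \<in> V" "q 0 \<in> V" "q' 0 \<in> V" using elim q'[of \<eta>] q'[of 0] by auto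
    have "G ?w \<le> \<bar>\<eta>\<bar>" using elim by (simp add: field_simps)
    moreover have "G (q \<eta> - q 0) \<le> G (cscale (of_real \<eta>) (q' 0)) + G ?w"
      using mem by (intro le_add_diff) auto
    ultimately show ?case using mem by (simp add: scale algebra_simps)
  qed
  then show ?thesis by blast
qed

lemma C1_path_derivative:
  assumes "C1_path l"
  shows "\<exists>d. (l has_vector_derivative d) (at 0)"
proof -
  have "at (0::real) within {-1..1} = at 0" by (rule at_within_interior) simp
  moreover obtain l' where
    "\<forall>\<epsilon>\<in>{-1..1}. (l has_vector_derivative l' \<epsilon>) (at \<epsilon> within {-1..1})"
    using assms unfolding C1_path_def by blast
  then have "(l has_vector_derivative l' 0) (at 0 within {-1..1})" by simp
  ultimately show ?thesis by auto
qed

locale coupled_oscillators =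
  fixes S :: "('n::finite, 'm::finite) oscillators"
    and Obs\<^sub>1 Den\<^sub>1 :: "(real^'n \<Rightarrow> complex) set"
    and Obs Den :: "'n joint set"
    and N :: "'n joint \<Rightarrow> real"
    and \<Lambda>\<^sub>1 :: complex
    and P\<^sub>0 Q\<^sub>1 P\<^sub>1 :: "real^'n \<Rightarrow> complex"
    and K T :: "real set"
    and \<kappa> \<tau> :: real
  assumes spaces: "function_spaces S Obs\<^sub>1 Den\<^sub>1 Obs N Den"
    and criteria: "coupled_oscillator_criteria S Obs\<^sub>1 Den\<^sub>1 Obs N Den \<Lambda>\<^sub>1 K T"
    and modes: "leading_modes (drift S) (noise_x S) Obs\<^sub>1 Den\<^sub>1 \<Lambda>\<^sub>1 P\<^sub>0 Q\<^sub>1 P\<^sub>1"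
    and multiplicity: "multiplicity_two S Obs Den \<Lambda>\<^sub>1 P\<^sub>0 Q\<^sub>1 P\<^sub>1"
    and parameters: "\<kappa> \<in> K" "\<tau> \<in> T"
begin

abbreviation "Q\<^sub>x \<equiv> mode_x Q\<^sub>1"
abbreviation "Q\<^sub>y \<equiv> mode_y Q\<^sub>1"
abbreviation "P\<^sub>x \<equiv> fmode_x P\<^sub>0 P\<^sub>1"
abbreviation "P\<^sub>y \<equiv> fmode_y P\<^sub>0 P\<^sub>1"
abbreviation "L \<equiv> \<lambda>u. bwd_x S u + bwd_y S u"
abbreviation "E \<equiv> bdom S Obs"

definition mode :: "2 \<Rightarrow> 'n joint" where
  "mode k = (if k = 1 then Q\<^sub>x else Q\<^sub>y)"

lemma dual: "dual_spaces Obs\<^sub>1 Den\<^sub>1" "dual_spaces Obs Den"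
  and banach: "banach_observables Obs N Den"
  using spaces by (auto simp: function_spaces_def)

lemma eigenvalue_nonzero: "\<Lambda>\<^sub>1 \<noteq> 0"
  using criteria
  by (auto simp: coupled_oscillator_criteria_def unperturbed_criteria_def robustly_oscillatory_def Let_def)

lemma eigenspaces:
  "u \<in> E \<and> L u = cscale \<Lambda>\<^sub>1 u \<longleftrightarrow> u \<in> cfun.span {Q\<^sub>x, Q\<^sub>y}"
  "p \<in> fdom S Den \<and> fwd S 0 0 p = cscale \<Lambda>\<^sub>1 p \<longleftrightarrow> p \<in> cfun.span {P\<^sub>x, P\<^sub>y}"
  using multiplicity by (auto simp: multiplicity_two_def eigenspace_def bwd_unperturbed)

lemma backward_modes: "Q\<^sub>x \<in> E" "Q\<^sub>y \<in> E" "L Q\<^sub>x = cscale \<Lambda>\<^sub>1 Q\<^sub>x" "L Q\<^sub>y = cscale \<Lambda>\<^sub>1 Q\<^sub>y"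
  using eigenspaces(1)[of Q\<^sub>x] eigenspaces(1)[of Q\<^sub>y] by (auto simp: cfun.span_base)

lemma forward_modes:
  "P\<^sub>x \<in> fdom S Den" "P\<^sub>y \<in> fdom S Den" "fwd S 0 0 P\<^sub>x = cscale \<Lambda>\<^sub>1 P\<^sub>x" "fwd S 0 0 P\<^sub>y = cscale \<Lambda>\<^sub>1 P\<^sub>y"
  using eigenspaces(2)[of P\<^sub>x] eigenspaces(2)[of P\<^sub>y] by (auto simp: cfun.span_base)

lemma forward_modes_Den: "P\<^sub>x \<in> Den" "P\<^sub>y \<in> Den"
  using forward_modes by (auto simp: fdom_def C2_domain_def)

lemma isolated_modes:
  "Q\<^sub>1 \<in> Obs\<^sub>1" "P\<^sub>0 \<in> Den\<^sub>1" "P\<^sub>1 \<in> Den\<^sub>1" "pairing Q\<^sub>1 P\<^sub>1 = 1" "(\<integral>x. P\<^sub>0 x \<partial>lborel) = 1"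
  using modes by (auto simp: leading_modes_def unique_stationary_def eigenspace_def bdom1_def fdom1_def
      C2_domain_def probability_density_def)

text \<open>\<open>Q\<^sub>1\<close> and \<open>P\<^sub>0\<close> belong to the different
  eigenvalues \<open>\<Lambda>\<^sub>1\<close> and 0 of formally adjoint operators.\<close>

lemma isolated_orthogonal: "pairing Q\<^sub>1 P\<^sub>0 = 0"
proof -
  let ?Lb = "bwd_osc (drift S) (noise_x S)" and ?Lf = "fwd_osc (drift S) (noise_x S)"
  have *: "Q\<^sub>1 \<in> bdom1 (drift S) (noise_x S) Obs\<^sub>1" "?Lb Q\<^sub>1 = cscale \<Lambda>\<^sub>1 Q\<^sub>1"
    "P\<^sub>0 \<in> fdom1 (drift S) (noise_x S) Den\<^sub>1" "?Lf P\<^sub>0 = 0"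
    using modes by (auto simp: leading_modes_def unique_stationary_def eigenspace_def)
  have "formally_adjoint ?Lb (bdom1 (drift S) (noise_x S) Obs\<^sub>1) ?Lf (fdom1 (drift S) (noise_x S) Den\<^sub>1)"
    using spaces by (auto simp: function_spaces_def)
  then have "pairing (?Lb Q\<^sub>1) P\<^sub>0 = pairing Q\<^sub>1 (?Lf P\<^sub>0)"
    using *(1,3) by (simp only: formally_adjoint_def)
  then have "\<Lambda>\<^sub>1 * pairing Q\<^sub>1 P\<^sub>0 = pairing Q\<^sub>1 0" by (simp add: *)
  then show ?thesis using eigenvalue_nonzero by (simp add: pairing_def pointwise)
qed

lemma isolated_integrable:
  "integrable lborel (\<lambda>x. Q\<^sub>1 x * P\<^sub>0 x)" "integrable lborel (\<lambda>x. Q\<^sub>1 x * P\<^sub>1 x)"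
  "integrable lborel P\<^sub>0" "integrable lborel P\<^sub>1"
  using dual(1) isolated_modes by (auto simp: dual_spaces_def)

text \<open>The modes are tensor products with a constant factor on the backward side. Diagonal
  pairings become 1 times the total mass of \<open>P\<^sub>0\<close>; the cross pairings contain the
  vanishing factor \<open>pairing Q\<^sub>1 P\<^sub>0\<close>.\<close>

lemma biorthonormal:
  "pairing Q\<^sub>x P\<^sub>x = 1" "pairing Q\<^sub>x P\<^sub>y = 0" "pairing Q\<^sub>y P\<^sub>x = 0" "pairing Q\<^sub>y P\<^sub>y = 1"
proof -
  have one: "pairing (\<lambda>_. 1) P\<^sub>0 = 1" using isolated_modes by (simp add: pairing_def)
  show "pairing Q\<^sub>x P\<^sub>x = 1"
    using pairing_tensor[of Q\<^sub>1 P\<^sub>1 "\<lambda>_. 1" P\<^sub>0] isolated_integrable isolated_modes(4) one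
    by (simp add: mode_x_def fmode_x_def)
  show "pairing Q\<^sub>x P\<^sub>y = 0"
    using pairing_tensor[of Q\<^sub>1 P\<^sub>0 "\<lambda>_. 1" P\<^sub>1] isolated_integrable isolated_orthogonal
    by (simp add: mode_x_def fmode_y_def mult.commute)
  show "pairing Q\<^sub>y P\<^sub>x = 0"
    using pairing_tensor[of "\<lambda>_. 1" P\<^sub>1 Q\<^sub>1 P\<^sub>0] isolated_integrable isolated_orthogonal
    by (simp add: mode_y_def fmode_x_def)
  show "pairing Q\<^sub>y P\<^sub>y = 1"
    using pairing_tensor[of "\<lambda>_. 1" P\<^sub>0 Q\<^sub>1 P\<^sub>1] isolated_integrable isolated_modes(4) one
    by (simp add: mode_y_def fmode_y_def mult.commute)
qed

abbreviation coord :: "'n joint \<Rightarrow> complex^2" where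
  "coord \<equiv> mode_coordinates P\<^sub>0 P\<^sub>1"

lemma coord_nth [simp]: "coord u $ 1 = pairing u P\<^sub>x" "coord u $ 2 = pairing u P\<^sub>y"
  by (simp_all add: mode_coordinates_def)

lemma coord_eqI: "pairing u P\<^sub>x = w $ 1 \<Longrightarrow> pairing u P\<^sub>y = w $ 2 \<Longrightarrow> coord u = w"
  by (simp add: complex_vec2_eq_iff)

lemma coord_bound: "\<exists>C. \<forall>u\<in>Obs. norm (coord u) \<le> C * N u"
proof -
  have "\<forall>p\<in>Den. \<exists>C. \<forall>u\<in>Obs. cmod (pairing u p) \<le> C * N u"
    using banach by (simp add: banach_observables_def)
  then obtain C D where C: "\<And>u. u \<in> Obs \<Longrightarrow> cmod (pairing u P\<^sub>x) \<le> C * N u"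
    and D: "\<And>u. u \<in> Obs \<Longrightarrow> cmod (pairing u P\<^sub>y) \<le> D * N u"
    using forward_modes_Den by blast
  have "norm (coord u) \<le> (C + D) * N u" if "u \<in> Obs" for u
  proof -
    have "norm (coord u) \<le> (\<Sum>i\<in>UNIV. cmod (coord u $ i))"
      unfolding norm_vec_def by (rule L2_set_le_sum) simp
    also have "\<dots> = cmod (pairing u P\<^sub>x) + cmod (pairing u P\<^sub>y)" by (simp add: sum_2)
    finally show ?thesis using C[OF that] D[OF that] by (simp add: distrib_right)
  qed
  then show ?thesis by blast
qed

definition coord_constant :: real where
  "coord_constant = (SOME C. \<forall>u\<in>Obs. norm (coord u) \<le> C * N u)"

lemma coord_constant: "u \<in> Obs \<Longrightarrow> norm (coord u) \<le> coord_constant * N u"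
  using someI_ex[OF coord_bound] unfolding coord_constant_def by blast

text \<open>Definiteness comes from the bound on compact sets, applied to singletons.\<close>

lemma normed_Obs: "complete_normed_functions Obs N"
proof
  show "cfun.subspace Obs" using dual(2) by (simp add: dual_spaces_def)
  show "complete_wrt N Obs" using banach by (simp add: banach_observables_def)
  fix u assume u: "u \<in> Obs" "N u = 0"
  have "u z = 0" for z
  proof -
    have cb: "\<forall>K. compact K \<longrightarrow> (\<exists>C. \<forall>u\<in>Obs. \<forall>z\<in>K. cmod (u z) \<le> C * N u)"
      using banach by (simp add: banach_observables_def)
    obtain C where "\<forall>u\<in>Obs. \<forall>x\<in>{z}. cmod (u x) \<le> C * N u"
      using cb[THEN spec, THEN mp, OF compact_sing[of z]] by (rule exE)
    then have "cmod (u z) \<le> C * N u" using u(1) by simp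
    then show ?thesis using u by simp
  qed
  then show "u = 0" by (simp add: fun_eq_iff pointwise)
qed (use banach in \<open>auto simp: banach_observables_def\<close>)

sublocale Obs: complete_normed_functions Obs N
  by (rule normed_Obs)

lemma subspace_E: "cfun.subspace E"
  using dual(2) by (auto simp: dual_spaces_def intro: subspace_bdom)

lemma linear_E: "linear_on E L" "linear_on E (bwd_tau S)" "linear_on E (bwd_kappa S)"
    "linear_on E (bwd_perturbation S \<kappa> \<tau>)"
  using linear_bwd_unperturbed linear_bwd_tau linear_bwd_kappa linear_bwd_perturbation
    linear_on_subset[OF _ bdom_subset(1)] by blast+

lemma perturbation_mem: "u \<in> E \<Longrightarrow> bwd_perturbation S \<kappa> \<tau> u \<in> Obs"
  by (simp add: bwd_perturbation_def bdomD)

lemma normed_E: "seminormed_functions E (graph_norm S N)"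
proof
  show "cfun.subspace E" by (rule subspace_E)
  fix u w c assume u: "u \<in> E"
  show "0 \<le> graph_norm S N u"
    using bdomD[OF u] by (simp add: graph_norm_def Obs.norm_nonneg)
  have "L (cscale c u) = cscale c (L u)" "bwd_tau S (cscale c u) = cscale c (bwd_tau S u)"
    "bwd_kappa S (cscale c u) = cscale c (bwd_kappa S u)"
    using linear_onD(2)[OF linear_E(1) u] linear_onD(2)[OF linear_E(2) u] linear_onD(2)[OF linear_E(3) u] by auto
  then show "graph_norm S N (cscale c u) = cmod c * graph_norm S N u"
    using bdomD[OF u] by (simp only: graph_norm_def Obs.scale distrib_left)
  assume w: "w \<in> E"
  have "L (u + w) = L u + L w" "bwd_tau S (u + w) = bwd_tau S u + bwd_tau S w"
    "bwd_kappa S (u + w) = bwd_kappa S u + bwd_kappa S w"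
    using linear_onD(1)[OF linear_E(1) u w] linear_onD(1)[OF linear_E(2) u w] linear_onD(1)[OF linear_E(3) u w] by auto
  then show "graph_norm S N (u + w) \<le> graph_norm S N u + graph_norm S N w"
    using Obs.add_le[OF bdomD(1)[OF u] bdomD(1)[OF w]] Obs.add_le[OF bdomD(2)[OF u] bdomD(2)[OF w]]
      Obs.add_le[OF bdomD(3)[OF u] bdomD(3)[OF w]] Obs.add_le[OF bdomD(4)[OF u] bdomD(4)[OF w]]
    unfolding graph_norm_def by simp
qed

lemma adjoint_pairing:
  assumes "u \<in> E" "p \<in> fdom S Den" "fwd S 0 0 p = cscale \<Lambda>\<^sub>1 p"
  shows "pairing (L u) p = \<Lambda>\<^sub>1 * pairing u p"
proof -
  have "formally_adjoint (bwd S 0 0) E (fwd S 0 0) (fdom S Den)"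
    using spaces by (auto simp: function_spaces_def)
  then have "pairing (bwd S 0 0 u) p = pairing u (fwd S 0 0 p)"
    using assms(1,2) unfolding formally_adjoint_def by blast
  then show ?thesis using assms(3) by (simp add: bwd_unperturbed)
qed

text \<open>The Fredholm condition quantifies over the forward eigenspace, which
  \<open>multiplicity_two\<close> identifies as the span of the two forward modes; it thus amounts
  to two vanishing pairings.\<close>

lemma solvable:
  assumes "f \<in> Obs" "coord f = 0"
  shows "\<exists>u\<in>E. L u - cscale \<Lambda>\<^sub>1 u = f"
proof -
  have "fredholm_alternative (\<lambda>u. bwd S 0 0 u - cscale z u) E Obs (\<lambda>p. fwd S 0 0 p - cscale z p) (fdom S Den)" for z
    using criteria unfolding coupled_oscillator_criteria_def unperturbed_criteria_def Let_def by blast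
  then have "(\<exists>u\<in>E. bwd S 0 0 u - cscale \<Lambda>\<^sub>1 u = f) \<longleftrightarrow>
      (\<forall>p\<in>fdom S Den. fwd S 0 0 p - cscale \<Lambda>\<^sub>1 p = 0 \<longrightarrow> pairing f p = 0)"
    using assms(1) unfolding fredholm_alternative_def by blast
  moreover have "pairing f p = 0" if "p \<in> fdom S Den" "fwd S 0 0 p - cscale \<Lambda>\<^sub>1 p = 0" for p
  proof -
    have "p \<in> cfun.span {P\<^sub>x, P\<^sub>y}" using eigenspaces(2)[of p] that by simp
    then obtain x y where p: "p = cscale x P\<^sub>x + cscale y P\<^sub>y" by (auto simp: span_pair)
    have "cscale x P\<^sub>x \<in> Den" "cscale y P\<^sub>y \<in> Den"
      using dual(2) forward_modes_Den cfun.subspace_scale by (auto simp: dual_spaces_def)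
    then have "pairing f p = x * pairing f P\<^sub>x + y * pairing f P\<^sub>y"
      using pairing_add_right[OF dual(2) assms(1)] by (simp add: p)
    then show ?thesis using assms(2) by (simp add: complex_vec2_eq_iff)
  qed
  ultimately show ?thesis by (simp add: bwd_unperturbed)
qed

lemma pairing_span: "coord (cscale x Q\<^sub>x + cscale y Q\<^sub>y) = vector [x, y]"
proof -
  have "cscale x Q\<^sub>x \<in> Obs" "cscale y Q\<^sub>y \<in> Obs"
    using backward_modes(1,2)[THEN bdomD(1)] by auto
  then show ?thesis
    using forward_modes_Den by (intro coord_eqI) (simp_all add: pairing_add[OF dual(2)] biorthonormal)
qed

lemma coord_mode: "coord (mode k) = axis k 1"
  using exhaust_2[of k] by (intro coord_eqI) (auto simp: mode_def axis_def biorthonormal)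

sublocale degenerate_perturbation Obs E N "graph_norm S N" L "bwd_perturbation S \<kappa> \<tau>" \<Lambda>\<^sub>1
  mode coord "\<bar>\<tau>\<bar> + \<bar>\<kappa>\<bar>" coord_constant
proof (intro degenerate_perturbation.intro degenerate_perturbation_axioms.intro normed_Obs normed_E)
  show "complete_wrt (graph_norm S N) E" using spaces by (simp add: function_spaces_def)
  show "E \<subseteq> Obs" by (rule bdom_subset)
  show "linear_on E L" "linear_on E (bwd_perturbation S \<kappa> \<tau>)" by (rule linear_E)+
  show "\<exists>u\<in>E. L u - cscale \<Lambda>\<^sub>1 u = f" if "f \<in> Obs" "coord f = 0" for f using that by (rule solvable)
  show "coord (mode k) = axis k 1" for k by (rule coord_mode)
  show "mode k \<in> E" "L (mode k) = cscale \<Lambda>\<^sub>1 (mode k)" for k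
    using backward_modes by (auto simp: mode_def)
  show "coord (cscale c u) = c *s coord u" for c u by (rule coord_eqI) auto
  show "coord (u + w) = coord u + coord w" if "u \<in> Obs" "w \<in> Obs" for u w
    using that forward_modes_Den by (intro coord_eqI) (auto simp: pairing_add[OF dual(2)])
  show "norm (coord u) \<le> coord_constant * N u" if "u \<in> Obs" for u using that by (rule coord_constant)
  fix u assume u: "u \<in> E"
  show "L u \<in> Obs" "bwd_perturbation S \<kappa> \<tau> u \<in> Obs" using u bdomD perturbation_mem by auto
  note nn = bdomD[OF u, THEN Obs.norm_nonneg]
  show "N u \<le> graph_norm S N u" "N (L u) \<le> graph_norm S N u"
    using nn by (auto simp: graph_norm_def)
  \<comment> \<open>The graph norm contains the detuning and coupling terms separately, which bounds
    the perturbation for every \<open>\<kappa>\<close> and \<open>\<tau>\<close>.\<close>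
  have "N (bwd_perturbation S \<kappa> \<tau> u) \<le> \<bar>\<tau>\<bar> * N (bwd_tau S u) + \<bar>\<kappa>\<bar> * N (bwd_kappa S u)"
    using Obs.add_le[of "cscale (of_real \<tau>) (bwd_tau S u)" "cscale (of_real \<kappa>) (bwd_kappa S u)"] bdomD[OF u]
    by (simp add: bwd_perturbation_def Obs.scale)
  also have "\<dots> \<le> \<bar>\<tau>\<bar> * graph_norm S N u + \<bar>\<kappa>\<bar> * graph_norm S N u"
    using nn by (intro add_mono mult_left_mono) (auto simp: graph_norm_def)
  finally show "N (bwd_perturbation S \<kappa> \<tau> u) \<le> (\<bar>\<tau>\<bar> + \<bar>\<kappa>\<bar>) * graph_norm S N u"
    by (simp add: distrib_right)
  show "coord (L u) = \<Lambda>\<^sub>1 *s coord u"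
    using adjoint_pairing[OF u] forward_modes by (intro coord_eqI) auto
  \<comment> \<open>By biorthonormality the coordinates of an eigenfunction are its coefficients in
    the two modes.\<close>
  assume "L u = cscale \<Lambda>\<^sub>1 u" "coord u = 0"
  then obtain x y where xy: "u = cscale x Q\<^sub>x + cscale y Q\<^sub>y"
    using eigenspaces(1)[of u] u by (auto simp: span_pair)
  then have "vector [x, y] = (0 :: complex^2)" using \<open>coord u = 0\<close> pairing_span by simp
  then have "x = 0" "y = 0" by (simp_all add: complex_vec2_eq_iff)
  then show "u = 0" by (simp add: xy)
qed

section \<open>Identification with the matrix and correction of the statement, and the perturbed
  modes\<close>

lemma comb_eq: "comb v = combination Q\<^sub>1 v"
  by (simp add: comb_def combination_def sum_2 mode_def)

lemma reduced_matrix_eq: "reduced_matrix = coupling_matrix S P\<^sub>0 Q\<^sub>1 P\<^sub>1 \<kappa> \<tau>"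
  by (simp add: reduced_matrix_def coupling_matrix_def Let_def vec_eq_iff forall_2 mode_def)

lemma correction_eq: "correction \<mu> v u \<longleftrightarrow> first_correction S Obs \<Lambda>\<^sub>1 P\<^sub>0 Q\<^sub>1 P\<^sub>1 \<kappa> \<tau> \<mu> v u"
  by (auto simp: correction_def first_correction_def comb_eq complex_vec2_eq_iff)

lemma modes_independent: "cfun.independent {Q\<^sub>x, Q\<^sub>y}" "Q\<^sub>x \<noteq> Q\<^sub>y"
proof -
  show "Q\<^sub>x \<noteq> Q\<^sub>y" using biorthonormal by force
  have "Q\<^sub>x \<noteq> cscale c Q\<^sub>y" for c using biorthonormal pairing_cscale[of c Q\<^sub>y P\<^sub>x] by force
  moreover have "Q\<^sub>y \<noteq> 0" using biorthonormal(4) by (auto simp: pairing_def pointwise)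
  ultimately show "cfun.independent {Q\<^sub>x, Q\<^sub>y}"
    by (auto simp: cfun.independent_insert cfun.span_singleton)
qed

text \<open>At \<epsilon> = 0 the family members with eigenvalue \<open>\<Lambda>\<^sub>1\<close>
  span the two-dimensional eigenspace. Two of them forming a basis are selected there, and their
  indices are followed to all other \<epsilon>. The spectral description covers nonzero eigenvalues
  only, so it matters that \<open>\<Lambda>\<^sub>1\<close> and all \<open>l k \<epsilon>\<close>
  are nonzero.\<close>

lemma perturbed_modes_exist: "\<exists>Q l. perturbed_modes S Obs N \<Lambda>\<^sub>1 \<kappa> \<tau> Q l"
proof -
  have "C1_eigenfamilies S Obs N Den \<kappa> \<tau>"
    using criteria parameters by (simp add: coupled_oscillator_criteria_def perturbation_criteria_def)
  then obtain I :: "nat set" and l q p where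
    smooth: "\<forall>k\<in>I. C1_path (l k) \<and> C1_family E (graph_norm S N) (q k) \<and> C1_family Den L1_norm (p k) \<and>
        (\<forall>\<epsilon>\<in>{-1..1}. l k \<epsilon> \<noteq> 0 \<and> q k \<epsilon> \<noteq> 0 \<and> p k \<epsilon> \<noteq> 0)" and
    spans: "\<forall>\<epsilon>\<in>{-1..1}. \<forall>z. z \<noteq> 0 \<longrightarrow>
        eigenspace (bwd S (\<epsilon> * \<kappa>) (\<epsilon> * \<tau>)) E z = cfun.span {q k \<epsilon> | k. k \<in> I \<and> l k \<epsilon> = z} \<and>
        eigenspace (fwd S (\<epsilon> * \<kappa>) (\<epsilon> * \<tau>)) (fdom S Den) z = cfun.span {p k \<epsilon> | k. k \<in> I \<and> l k \<epsilon> = z}"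
    unfolding C1_eigenfamilies_def by (elim exE conjE) (rule that)
  have eigen: "eigenspace (bwd S (\<epsilon> * \<kappa>) (\<epsilon> * \<tau>)) E z = cfun.span {q k \<epsilon> | k. k \<in> I \<and> l k \<epsilon> = z}"
    if "\<epsilon> \<in> {-1..1}" "z \<noteq> 0" for \<epsilon> z
    using spans[THEN bspec, OF that(1), THEN spec, THEN mp, OF that(2)] by (rule conjunct1)
  have start: "eigenspace (bwd S 0 0) E \<Lambda>\<^sub>1 = cfun.span {Q\<^sub>x, Q\<^sub>y}"
    using multiplicity by (simp add: multiplicity_two_def)
  have "cfun.span {q k 0 | k. k \<in> I \<and> l k 0 = \<Lambda>\<^sub>1} = cfun.span {Q\<^sub>x, Q\<^sub>y}"
    using eigen[of 0 \<Lambda>\<^sub>1] eigenvalue_nonzero start by simp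
  then obtain c d where cd: "c \<in> {q k 0 | k. k \<in> I \<and> l k 0 = \<Lambda>\<^sub>1}" "d \<in> {q k 0 | k. k \<in> I \<and> l k 0 = \<Lambda>\<^sub>1}"
      "cfun.span {c, d} = cfun.span {Q\<^sub>x, Q\<^sub>y}"
    by (rule basis_of_two_dimensional_span[OF _ modes_independent])
  obtain i where i: "c = q i 0" "i \<in> I" "l i 0 = \<Lambda>\<^sub>1" using cd(1) by blast
  obtain j where j: "d = q j 0" "j \<in> I" "l j 0 = \<Lambda>\<^sub>1" using cd(2) by blast
  define k where "k s = (case s of Upper \<Rightarrow> i | Lower \<Rightarrow> j)" for s
  have k: "k s \<in> I" "l (k s) 0 = \<Lambda>\<^sub>1" for s using i j by (auto simp: k_def split: sign.split)
  have "q (k s) \<epsilon> \<in> eigenspace (bwd S (\<epsilon> * \<kappa>) (\<epsilon> * \<tau>)) E (l (k s) \<epsilon>)" if "\<epsilon> \<in> {-1..1}" for s \<epsilon>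
  proof -
    have "l (k s) \<epsilon> \<noteq> 0" using smooth k(1) that by blast
    moreover have "q (k s) \<epsilon> \<in> cfun.span {q i \<epsilon> | i. i \<in> I \<and> l i \<epsilon> = l (k s) \<epsilon>}"
      using k(1) by (intro cfun.span_base) blast
    ultimately show ?thesis using eigen[OF that] by simp
  qed
  moreover have "cfun.span {q (k Upper) 0, q (k Lower) 0} = eigenspace (bwd S 0 0) E \<Lambda>\<^sub>1"
    using cd(3) i j start by (simp add: k_def)
  ultimately have "perturbed_modes S Obs N \<Lambda>\<^sub>1 \<kappa> \<tau> (\<lambda>s. q (k s)) (\<lambda>s. l (k s))"
    unfolding perturbed_modes_def using smooth k by blast
  then show ?thesis by blast
qed

lemma eigenpair_families:
  assumes pm: "perturbed_modes S Obs N \<Lambda>\<^sub>1 \<kappa> \<tau> Q l"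
  obtains \<mu> C where
    "\<And>s. eigenpair_family Obs E N (graph_norm S N) L (bwd_perturbation S \<kappa> \<tau>) \<Lambda>\<^sub>1 mode coord
      (\<bar>\<tau>\<bar> + \<bar>\<kappa>\<bar>) coord_constant (Q s) (l s) (\<mu> s) (C s)"
proof -
  have pm': "C1_path (l s)" "C1_family E (graph_norm S N) (Q s)" "l s 0 = \<Lambda>\<^sub>1"
    "\<epsilon> \<in> {-1..1} \<Longrightarrow> Q s \<epsilon> \<noteq> 0 \<and> Q s \<epsilon> \<in> eigenspace (bwd S (\<epsilon> * \<kappa>) (\<epsilon> * \<tau>)) E (l s \<epsilon>)" for s \<epsilon>
    using pm unfolding perturbed_modes_def by blast+
  have "\<forall>s. \<exists>\<mu>. (l s has_vector_derivative \<mu>) (at 0)"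
    by (rule allI) (rule C1_path_derivative[OF pm'(1)])
  from choice[OF this] obtain \<mu> where \<mu>: "\<forall>s. (l s has_vector_derivative \<mu> s) (at 0)" by (rule exE)
  have "\<forall>s. \<exists>C. \<forall>\<^sub>F \<epsilon> in at 0. Q s \<epsilon> \<in> E \<and> graph_norm S N (Q s \<epsilon> - Q s 0) \<le> C * \<bar>\<epsilon>\<bar>"
    by (rule allI) (rule C1_family_Lipschitz[OF pm'(2) normed_E])
  from choice[OF this] obtain C where C: "\<forall>s. \<forall>\<^sub>F \<epsilon> in at 0. Q s \<epsilon> \<in> E \<and> graph_norm S N (Q s \<epsilon> - Q s 0) \<le> C s * \<bar>\<epsilon>\<bar>" by (rule exE)
  have small: "\<forall>\<^sub>F \<epsilon>::real in at 0. \<epsilon> \<in> {-1..1}"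
    by (auto simp: eventually_at dist_real_def intro!: exI[of _ 1])
  have eq: "L (Q s \<epsilon>) + cscale (of_real \<epsilon>) (bwd_perturbation S \<kappa> \<tau> (Q s \<epsilon>)) = cscale (l s \<epsilon>) (Q s \<epsilon>)"
    if "\<epsilon> \<in> {-1..1}" for s \<epsilon>
    using pm'(4)[OF that, of s] by (simp add: eigenspace_def bwd_eq)
  have "eigenpair_family Obs E N (graph_norm S N) L (bwd_perturbation S \<kappa> \<tau>) \<Lambda>\<^sub>1 mode coord
      (\<bar>\<tau>\<bar> + \<bar>\<kappa>\<bar>) coord_constant (Q s) (l s) (\<mu> s) (C s)" for s
  proof (intro eigenpair_family.intro eigenpair_family_axioms.intro degenerate_perturbation_axioms)
    show "\<forall>\<^sub>F \<epsilon> in at 0. Q s \<epsilon> \<in> E \<and>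
      L (Q s \<epsilon>) + cscale (of_real \<epsilon>) (bwd_perturbation S \<kappa> \<tau> (Q s \<epsilon>)) = cscale (l s \<epsilon>) (Q s \<epsilon>) \<and>
      graph_norm S N (Q s \<epsilon> - Q s 0) \<le> C s * \<bar>\<epsilon>\<bar>"
      using C[THEN spec, of s] small by eventually_elim (use eq in blast)
    show "Q s 0 \<in> E" "Q s 0 \<noteq> 0" using pm'(4)[of 0 s] by (auto simp: eigenspace_def)
    show "L (Q s 0) = cscale \<Lambda>\<^sub>1 (Q s 0)" using eq[of 0 s] pm'(3)[of s] by simp
  qed (use pm' \<mu> in auto)
  then show thesis by (rule that)
qed

end

theorem theorem3:
  fixes S :: "('n::finite, 'm::finite) oscillators"
    and Obs\<^sub>1 Den\<^sub>1 :: "(real^'n \<Rightarrow> complex) set"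
    and Obs Den :: "'n joint set"
    and N :: "'n joint \<Rightarrow> real"
    and \<Lambda>\<^sub>1 :: complex
    and P\<^sub>0 Q\<^sub>1 P\<^sub>1 :: "real^'n \<Rightarrow> complex"
    and K T :: "real set"
    and \<kappa> \<tau> :: real
    and \<Lambda>\<^sub>c :: "sign \<Rightarrow> complex"
    and v :: "sign \<Rightarrow> complex^2"
  assumes "regular_coefficients S"
    and "noise_x S = noise_y S"
    and "function_spaces S Obs\<^sub>1 Den\<^sub>1 Obs N Den"
    and "coupled_oscillator_criteria S Obs\<^sub>1 Den\<^sub>1 Obs N Den \<Lambda>\<^sub>1 K T"
    and "leading_modes (drift S) (noise_x S) Obs\<^sub>1 Den\<^sub>1 \<Lambda>\<^sub>1 P\<^sub>0 Q\<^sub>1 P\<^sub>1"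
    and "multiplicity_two S Obs Den \<Lambda>\<^sub>1 P\<^sub>0 Q\<^sub>1 P\<^sub>1"
    and "\<kappa> \<in> K" and "\<tau> \<in> T"
    and "diagonalized_by (coupling_matrix S P\<^sub>0 Q\<^sub>1 P\<^sub>1 \<kappa> \<tau>) \<Lambda>\<^sub>c v"
  shows
    "(\<forall>s. \<exists>!Q\<^sub>c. first_correction S Obs \<Lambda>\<^sub>1 P\<^sub>0 Q\<^sub>1 P\<^sub>1 \<kappa> \<tau> (\<Lambda>\<^sub>c s) (v s) Q\<^sub>c) \<and>
     (\<exists>Q l. perturbed_modes S Obs N \<Lambda>\<^sub>1 \<kappa> \<tau> Q l) \<and>
     (\<forall>Q l. perturbed_modes S Obs N \<Lambda>\<^sub>1 \<kappa> \<tau> Q l \<longrightarrow>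
        (\<exists>\<Lambda>\<^sub>c' v'.
           diagonalized_by (coupling_matrix S P\<^sub>0 Q\<^sub>1 P\<^sub>1 \<kappa> \<tau>) \<Lambda>\<^sub>c' v' \<and>
           same_eigenpairs \<Lambda>\<^sub>c v \<Lambda>\<^sub>c' v' \<and>
           (\<forall>s. Q s 0 = combination Q\<^sub>1 (v' s) \<and>
              (\<lambda>\<epsilon>. norm (l s \<epsilon> - (\<Lambda>\<^sub>1 + of_real \<epsilon> * \<Lambda>\<^sub>c' s))) \<in> O[at 0](\<lambda>\<epsilon>. \<epsilon>\<^sup>2) \<and>
              (\<forall>Q\<^sub>c. first_correction S Obs \<Lambda>\<^sub>1 P\<^sub>0 Q\<^sub>1 P\<^sub>1 \<kappa> \<tau> (\<Lambda>\<^sub>c' s) (v' s) Q\<^sub>c \<longrightarrow>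
                 (\<lambda>\<epsilon>. graph_norm S N (Q s \<epsilon> -
                    (combination Q\<^sub>1 (mode_coordinates P\<^sub>0 P\<^sub>1 (Q s \<epsilon>)) + cscale (of_real \<epsilon>) Q\<^sub>c)))
                   \<in> O[at 0](\<lambda>\<epsilon>. \<epsilon>\<^sup>2) \<and>
                 (normalized_at P\<^sub>0 P\<^sub>1 (v' s) (Q s) \<longrightarrow>
                    (\<lambda>\<epsilon>. graph_norm S N (Q s \<epsilon> -
                       (combination Q\<^sub>1 (v' s) + cscale (of_real \<epsilon>) Q\<^sub>c)))
                      \<in> O[at 0](\<lambda>\<epsilon>. \<epsilon>\<^sup>2))))))"
proof -
  interpret coupled_oscillators S Obs\<^sub>1 Den\<^sub>1 Obs Den N \<Lambda>\<^sub>1 P\<^sub>0 Q\<^sub>1 P\<^sub>1 K T \<kappa> \<tau>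
    using assms by unfold_locales
  define M where "M = coupling_matrix S P\<^sub>0 Q\<^sub>1 P\<^sub>1 \<kappa> \<tau>"
  have diag: "diagonalized_by M \<Lambda>\<^sub>c v" using assms by (simp add: M_def)
  have "\<exists>!Q\<^sub>c. first_correction S Obs \<Lambda>\<^sub>1 P\<^sub>0 Q\<^sub>1 P\<^sub>1 \<kappa> \<tau> (\<Lambda>\<^sub>c s) (v s) Q\<^sub>c" for s
    using ex1_correction[of "v s" "\<Lambda>\<^sub>c s"] diag unfolding correction_eq reduced_matrix_eq
    by (simp add: diagonalized_by_iff M_def)
  moreover have "\<exists>\<Lambda>\<^sub>c' v'. diagonalized_by M \<Lambda>\<^sub>c' v' \<and> same_eigenpairs \<Lambda>\<^sub>c v \<Lambda>\<^sub>c' v' \<and>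
      (\<forall>s. Q s 0 = combination Q\<^sub>1 (v' s) \<and>
        (\<lambda>\<epsilon>. norm (l s \<epsilon> - (\<Lambda>\<^sub>1 + of_real \<epsilon> * \<Lambda>\<^sub>c' s))) \<in> O[at 0](\<lambda>\<epsilon>. \<epsilon>\<^sup>2) \<and>
        (\<forall>Q\<^sub>c. first_correction S Obs \<Lambda>\<^sub>1 P\<^sub>0 Q\<^sub>1 P\<^sub>1 \<kappa> \<tau> (\<Lambda>\<^sub>c' s) (v' s) Q\<^sub>c \<longrightarrow>
           (\<lambda>\<epsilon>. graph_norm S N (Q s \<epsilon> - (combination Q\<^sub>1 (coord (Q s \<epsilon>)) + cscale (of_real \<epsilon>) Q\<^sub>c)))
             \<in> O[at 0](\<lambda>\<epsilon>. \<epsilon>\<^sup>2) \<and>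
           (normalized_at P\<^sub>0 P\<^sub>1 (v' s) (Q s) \<longrightarrow>
              (\<lambda>\<epsilon>. graph_norm S N (Q s \<epsilon> - (combination Q\<^sub>1 (v' s) + cscale (of_real \<epsilon>) Q\<^sub>c)))
                \<in> O[at 0](\<lambda>\<epsilon>. \<epsilon>\<^sup>2))))"
    if pm: "perturbed_modes S Obs N \<Lambda>\<^sub>1 \<kappa> \<tau> Q l" for Q l
  proof -
    obtain \<mu> C where family: "\<And>s. eigenpair_family Obs E N (graph_norm S N) L (bwd_perturbation S \<kappa> \<tau>)
        \<Lambda>\<^sub>1 mode coord (\<bar>\<tau>\<bar> + \<bar>\<kappa>\<bar>) coord_constant (Q s) (l s) (\<mu> s) (C s)"
      using eigenpair_families[OF pm] by blast
    \<comment> \<open>The eigenpairs of \<open>M\<close> are read off the given family: eigenvectors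
      from its starting coordinates, eigenvalues \<open>\<mu> s\<close> from the derivatives of
      \<open>l s\<close>.\<close>
    define v' where "v' s = coord (Q s 0)" for s
    have start: "Q s 0 = combination Q\<^sub>1 (v' s)" for s
      using eigenpair_family.comb_start[OF family[of s]] by (simp add: comb_eq v'_def)
    have mem: "Q s 0 \<in> Obs" for s
      using eigenpair_family.start(1)[OF family[of s]] by (rule in_X)
    have span: "cfun.span {Q Upper 0, Q Lower 0} = cfun.span {Q\<^sub>x, Q\<^sub>y}"
      using pm multiplicity by (simp add: perturbed_modes_def multiplicity_two_def)
    \<comment> \<open>Independence of \<open>v'\<close>: the coordinates of \<open>Q\<^sub>x\<close>
      and \<open>Q\<^sub>y\<close> are the two unit vectors, and both are combinations of
      \<open>v' Upper\<close> and \<open>v' Lower\<close>, so the determinant of the latter cannot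
      vanish.\<close>
    have coords: "\<exists>x y. coord u = x *s v' Upper + y *s v' Lower" if "u \<in> {Q\<^sub>x, Q\<^sub>y}" for u
    proof -
      have "u \<in> cfun.span {Q Upper 0, Q Lower 0}" unfolding span using that by (rule cfun.span_base)
      then obtain x y where "u = cscale x (Q Upper 0) + cscale y (Q Lower 0)" by (auto simp: span_pair)
      then show ?thesis using mem by (auto simp: coord_add coord_scale v'_def)
    qed
    obtain a b where ab: "coord Q\<^sub>x = a *s v' Upper + b *s v' Lower" using coords by blast
    obtain c d where cd: "coord Q\<^sub>y = c *s v' Upper + d *s v' Lower" using coords by blast
    have "v' Upper $ 1 * v' Lower $ 2 \<noteq> v' Upper $ 2 * v' Lower $ 1"
      using ab cd by (simp add: complex_vec2_eq_iff biorthonormal) algebra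
    then have diag': "diagonalized_by M \<mu> v'"
      using eigenpair_family.reduced_eigenvector[OF family]
      by (simp add: diagonalized_by_iff reduced_matrix_eq M_def v'_def)
    show ?thesis
    proof (intro exI conjI allI impI)
      show "diagonalized_by M \<mu> v'" by fact
      show "same_eigenpairs \<Lambda>\<^sub>c v \<mu> v'" using diag diag' by (rule diagonalized_same_eigenpairs)
      fix s
      show "Q s 0 = combination Q\<^sub>1 (v' s)" by (rule start)
      show "(\<lambda>\<epsilon>. norm (l s \<epsilon> - (\<Lambda>\<^sub>1 + of_real \<epsilon> * \<mu> s))) \<in> O[at 0](\<lambda>\<epsilon>. \<epsilon>\<^sup>2)"
        by (rule eigenpair_family.eigenvalue_expansion[OF family])
      fix Q\<^sub>c assume "first_correction S Obs \<Lambda>\<^sub>1 P\<^sub>0 Q\<^sub>1 P\<^sub>1 \<kappa> \<tau> (\<mu> s) (v' s) Q\<^sub>c"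
      then have Qc: "correction (\<mu> s) (coord (Q s 0)) Q\<^sub>c" by (simp add: correction_eq v'_def)
      show "(\<lambda>\<epsilon>. graph_norm S N (Q s \<epsilon> - (combination Q\<^sub>1 (coord (Q s \<epsilon>)) + cscale (of_real \<epsilon>) Q\<^sub>c)))
             \<in> O[at 0](\<lambda>\<epsilon>. \<epsilon>\<^sup>2)"
        using eigenpair_family.eigenfunction_expansion[OF family Qc] unfolding comb_eq .
      assume "normalized_at P\<^sub>0 P\<^sub>1 (v' s) (Q s)"
      then show "(\<lambda>\<epsilon>. graph_norm S N (Q s \<epsilon> - (combination Q\<^sub>1 (v' s) + cscale (of_real \<epsilon>) Q\<^sub>c)))
                \<in> O[at 0](\<lambda>\<epsilon>. \<epsilon>\<^sup>2)"
        using eigenpair_family.normalized_eigenfunction_expansion[OF family Qc]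
        unfolding comb_eq normalized_at_def v'_def by blast
    qed
  qed
  ultimately show ?thesis using perturbed_modes_exist unfolding M_def by blast
qed

end
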